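(* An $H$-contact structure $(\phi,\xi,\eta,g)$ on $M^{2n+1}$ is harmonic if and only if the $*$-Ricci curvature $\rho^*$ of $M$ is symmetric, i.e. $\rho^*(X,Y)=\rho^*(Y,X)$ for all $X,Y\in TM$.
   Context: An almost contact metric structure on a Riemannian manifold $(M^{2n+1},g)$ consists of a $(1,1)$-tensor $\phi$, a unit vector field $\xi$ and its dual $1$-form $\eta=g(\xi,\cdot)$, with $\phi^2=-I+\eta\otimes\xi$ and $g(\phi X,\phi Y)=g(X,Y)-\eta(X)\eta(Y)$. It is a contact metric structure if $d\eta=\Phi$, where $\Phi(X,Y)=g(X,\phi Y)$ and $d\eta(X,Y)=\tfrac12\big(X\eta(Y)-Y\eta(X)-\eta([X,Y])\big)$. Everything is smooth. $\nabla$ is the Levi-Civita connection; $\mathcal{D}=\operatorname{im}\phi=\ker\eta$; $J=\phi|_{\mathcal D}$; $\bar\nabla$ is the connection in $\mathcal{D}\to M$ given by $\bar\nabla_XY=(\nabla_XY)_{\mathcal D}$ (orthogonal projection), $X\in TM$, $Y$ a section of $\mathcal D$. $\nabla^2_{X,Y}=\nabla_X\nabla_Y-\nabla_{\nabla_XY}$ and $\bar\nabla^2_{X,Y}=\bar\nabla_X\bar\nabla_Y-\bar\nabla_{\nabla_XY}$. For a local orthonormal frame $(E_i)$ of $TM$ (sums over repeated indices): $\nabla^*\nabla\xi=-\nabla^2_{E_i,E_i}\xi$, $\bar\nabla^*\bar\nabla J=-\bar\nabla^2_{E_i,E_i}J$, and $$\tau(\xi)=\nabla^*\nabla\xi-|\nabla\xi|^2\xi,\quad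 \tau(J)=[\bar\nabla^*\bar\nabla J,J],\quad T(\phi)=(\bar\nabla_{E_i}J)\big(\nabla_{E_i}\xi\big),$$ where $[\cdot,\cdot]$ is the commutator of endomorphisms of $\mathcal D$ (note that $\nabla_X\xi\in\mathcal D$). The almost contact metric structure is harmonic if it is given by a harmonic section of the associated bundle with fibre $SO(2n+1)/U(n)$; equivalently (known result, used here as the definition), if both $\tau(\xi)+\tfrac12 J\,T(\phi)=0$ and $\tau(J)=0$ hold. A contact metric structure is $H$-contact if $\xi$ is a harmonic unit vector field, i.e. $\tau(\xi)=0$. The Riemann curvature tensor is $R(X,Y)=\nabla^2_{X,Y}-\nabla^2_{Y,X}$, and the $*$-Ricci curvature of $M$ is $\rho^*(X,Y)=g(R(X,E_i)\phi E_i,\phi Y)$ for all $X,Y\in TM$. *)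

theory Defs
  imports "HOL-Analysis.Analysis" "HOL-Library.Function_Algebras"
begin

text \<open>Together with Function_Algebras this makes pointwise vector space operations available on
  functions, on tangent vectors (functionals on functions) and on vector fields.\<close>

instantiation "fun" :: (type, real_vector) real_vector
begin

definition scaleR_fun :: "real \<Rightarrow> ('a \<Rightarrow> 'b) \<Rightarrow> 'a \<Rightarrow> 'b"
  where "scaleR_fun c f = (\<lambda>x. c *\<^sub>R f x)"

instance
  by standard (simp_all add: scaleR_fun_def plus_fun_def fun_eq_iff algebra_simps)

end

text \<open>\<open>k\<close> times continuously differentiable maps; meant for open \<open>S\<close> only.\<close>

primrec Ck_on ::
  "nat \<Rightarrow> ('e::euclidean_space \<Rightarrow> 'f::real_normed_vector) \<Rightarrow> 'e set \<Rightarrow> bool" where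
  "Ck_on 0 f S \<longleftrightarrow> continuous_on S f"
| "Ck_on (Suc k) f S \<longleftrightarrow>
     (\<forall>x\<in>S. f differentiable (at x)) \<and> (\<forall>v. Ck_on k (\<lambda>x. frechet_derivative f (at x) v) S)"

definition smooth_on :: "('e::euclidean_space \<Rightarrow> 'f::real_normed_vector) \<Rightarrow> 'e set \<Rightarrow> bool"
  where "smooth_on f S \<longleftrightarrow> (\<forall>k. Ck_on k f S)"

type_synonym 'a tangent = "('a \<Rightarrow> real) \<Rightarrow> real"
type_synonym 'a vfield = "'a \<Rightarrow> 'a tangent"

definition fscale :: "('a \<Rightarrow> real) \<Rightarrow> 'a vfield \<Rightarrow> 'a vfield"  (infixr "\<cdot>" 75)
  where "f \<cdot> X = (\<lambda>p. f p *\<^sub>R X p)"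

text \<open>A chart is a pair of its domain and its coordinate map; the values of the coordinate map
  outside the domain are irrelevant. The dimension of the manifold is the dimension of the model
  space \<open>'e\<close>.\<close>

locale smooth_manifold =
  fixes M :: "'a topology"
    and charts :: "('a set \<times> ('a \<Rightarrow> 'e::euclidean_space)) set"
  assumes Hausdorff: "Hausdorff_space M"
    and second_countable: "second_countable M"
    and charts_cover: "(\<Union>(V, x)\<in>charts. V) = topspace M"
    and chart_homeo: "(V, x) \<in> charts \<Longrightarrow>
        openin M V \<and> open (x ` V) \<and>
        homeomorphic_map (subtopology M V) (top_of_set (x ` V)) x"
    and chart_change: "(V, x) \<in> charts \<Longrightarrow> (W, y) \<in> charts \<Longrightarrow>
        smooth_on (y \<circ> inv_into V x) (x ` (V \<inter> W))"
begin

text \<open>Local functions and local vector fields are represented by total functions which are only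
  constrained on an open set.\<close>

definition smooth_fun_on :: "'a set \<Rightarrow> ('a \<Rightarrow> real) \<Rightarrow> bool" where
  "smooth_fun_on U f \<longleftrightarrow> openin M U \<and>
     (\<forall>(V, x)\<in>charts. smooth_on (f \<circ> inv_into V x) (x ` (V \<inter> U)))"

definition smooth_fun_near :: "'a \<Rightarrow> ('a \<Rightarrow> real) \<Rightarrow> bool" where
  "smooth_fun_near p f \<longleftrightarrow> (\<exists>U. p \<in> U \<and> smooth_fun_on U f)"

text \<open>The tangent space at \<open>p\<close>: derivations of the functions which are smooth near \<open>p\<close>. That a
  derivation only depends on the germ at \<open>p\<close> follows from the product rule, since the indicator
  function of an open neighbourhood of \<open>p\<close> is smooth near \<open>p\<close>. The last condition fixes the
  irrelevant values.\<close>

definition tangent_space :: "'a \<Rightarrow> 'a tangent set" where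
  "tangent_space p = {v.
     (\<forall>f h. smooth_fun_near p f \<longrightarrow> smooth_fun_near p h \<longrightarrow>
        v (f + h) = v f + v h \<and> v (f * h) = f p * v h + h p * v f) \<and>
     (\<forall>c f. smooth_fun_near p f \<longrightarrow> v (c *\<^sub>R f) = c * v f) \<and>
     (\<forall>f. \<not> smooth_fun_near p f \<longrightarrow> v f = 0)}"

definition vector_field_on :: "'a set \<Rightarrow> 'a vfield \<Rightarrow> bool" where
  "vector_field_on U X \<longleftrightarrow> openin M U \<and> (\<forall>p\<in>U. X p \<in> tangent_space p) \<and>
     (\<forall>V f. V \<subseteq> U \<longrightarrow> smooth_fun_on V f \<longrightarrow> smooth_fun_on V (\<lambda>p. X p f))"

definition lie_bracket :: "'a vfield \<Rightarrow> 'a vfield \<Rightarrow> 'a vfield" where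
  "lie_bracket X Y = (\<lambda>p f. if smooth_fun_near p f
     then X p (\<lambda>q. Y q f) - Y p (\<lambda>q. X q f) else 0)"

definition tensor11 :: "('a \<Rightarrow> 'a tangent \<Rightarrow> 'a tangent) \<Rightarrow> bool" where
  "tensor11 A \<longleftrightarrow>
     (\<forall>p\<in>topspace M. \<forall>u\<in>tangent_space p. \<forall>v\<in>tangent_space p. \<forall>c.
        A p u \<in> tangent_space p \<and> A p (u + v) = A p u + A p v \<and> A p (c *\<^sub>R u) = c *\<^sub>R A p u) \<and>
     (\<forall>U X. vector_field_on U X \<longrightarrow> vector_field_on U (\<lambda>p. A p (X p)))"

definition riemannian_metric :: "('a \<Rightarrow> 'a tangent \<Rightarrow> 'a tangent \<Rightarrow> real) \<Rightarrow> bool" where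
  "riemannian_metric g \<longleftrightarrow>
     (\<forall>p\<in>topspace M. \<forall>u\<in>tangent_space p. \<forall>v\<in>tangent_space p. \<forall>w\<in>tangent_space p. \<forall>c.
        g p (u + v) w = g p u w + g p v w \<and> g p (c *\<^sub>R u) w = c * g p u w \<and>
        g p u v = g p v u \<and> (u \<noteq> 0 \<longrightarrow> g p u u > 0)) \<and>
     (\<forall>U X Y. vector_field_on U X \<longrightarrow> vector_field_on U Y \<longrightarrow>
        smooth_fun_on U (\<lambda>p. g p (X p) (Y p)))"

text \<open>A connection acts on local vector fields. All conditions are imposed over every open \<open>U\<close>;
  taking for \<open>f\<close> indicator functions of open sets, they imply that the operator is local.\<close>

definition affine_connection :: "('a vfield \<Rightarrow> 'a vfield \<Rightarrow> 'a vfield) \<Rightarrow> bool" where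
  "affine_connection nabla \<longleftrightarrow>
     (\<forall>U X Y Z f. vector_field_on U X \<longrightarrow> vector_field_on U Y \<longrightarrow> vector_field_on U Z \<longrightarrow>
        smooth_fun_on U f \<longrightarrow>
        vector_field_on U (nabla X Y) \<and>
        (\<forall>p\<in>U. nabla (X + Y) Z p = nabla X Z p + nabla Y Z p \<and>
               nabla (f \<cdot> X) Y p = f p *\<^sub>R nabla X Y p \<and>
               nabla X (Y + Z) p = nabla X Y p + nabla X Z p \<and>
               nabla X (f \<cdot> Y) p = X p f *\<^sub>R Y p + f p *\<^sub>R nabla X Y p))"

definition levi_civita_connection ::
  "('a \<Rightarrow> 'a tangent \<Rightarrow> 'a tangent \<Rightarrow> real) \<Rightarrow> ('a vfield \<Rightarrow> 'a vfield \<Rightarrow> 'a vfield) \<Rightarrow> bool" where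
  "levi_civita_connection g nabla \<longleftrightarrow> affine_connection nabla \<and>
     (\<forall>U X Y Z. vector_field_on U X \<longrightarrow> vector_field_on U Y \<longrightarrow> vector_field_on U Z \<longrightarrow>
        (\<forall>p\<in>U. nabla X Y p - nabla Y X p = lie_bracket X Y p \<and>
               X p (\<lambda>q. g q (Y q) (Z q)) = g p (nabla X Y p) (Z p) + g p (Y p) (nabla X Z p)))"

end

text \<open>\<open>\<nabla>\<close> is the Levi-Civita connection: the hypothesis \<open>levi_civita\<close> determines it on local vector
  fields, and its other values are never used.\<close>

locale almost_contact_metric_structure = smooth_manifold M charts
  for M :: "'a topology" and charts :: "('a set \<times> ('a \<Rightarrow> 'e::euclidean_space)) set" +
  fixes g :: "'a \<Rightarrow> 'a tangent \<Rightarrow> 'a tangent \<Rightarrow> real"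
    and nabla :: "'a vfield \<Rightarrow> 'a vfield \<Rightarrow> 'a vfield"  ("\<nabla>")
    and phi :: "'a \<Rightarrow> 'a tangent \<Rightarrow> 'a tangent"  ("\<phi>")
    and xi :: "'a vfield"  ("\<xi>")
    and eta :: "'a \<Rightarrow> 'a tangent \<Rightarrow> real"  ("\<eta>")
  assumes metric: "riemannian_metric g"
    and levi_civita: "levi_civita_connection g \<nabla>"
    and phi_tensor: "tensor11 \<phi>"
    and xi_field: "vector_field_on (topspace M) \<xi>"
    and xi_unit: "p \<in> topspace M \<Longrightarrow> g p (\<xi> p) (\<xi> p) = 1"
    and eta_dual: "p \<in> topspace M \<Longrightarrow> v \<in> tangent_space p \<Longrightarrow> \<eta> p v = g p (\<xi> p) v"
    and phi_phi: "p \<in> topspace M \<Longrightarrow> v \<in> tangent_space p \<Longrightarrow>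
        \<phi> p (\<phi> p v) = - v + \<eta> p v *\<^sub>R \<xi> p"
    and phi_compat: "p \<in> topspace M \<Longrightarrow> u \<in> tangent_space p \<Longrightarrow> v \<in> tangent_space p \<Longrightarrow>
        g p (\<phi> p u) (\<phi> p v) = g p u v - \<eta> p u * \<eta> p v"
begin

definition orthonormal_frame_on :: "'a set \<Rightarrow> (nat \<Rightarrow> 'a vfield) \<Rightarrow> bool" where
  "orthonormal_frame_on U E \<longleftrightarrow> openin M U \<and>
     (\<forall>i<DIM('e). vector_field_on U (E i)) \<and>
     (\<forall>p\<in>U. (\<forall>i<DIM('e). \<forall>j<DIM('e). g p (E i p) (E j p) = (if i = j then 1 else 0)) \<and>
            span ((\<lambda>i. E i p) ` {..<DIM('e)}) = tangent_space p)"

definition deta :: "'a vfield \<Rightarrow> 'a vfield \<Rightarrow> 'a \<Rightarrow> real" where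
  "deta X Y p = 1/2 * (X p (\<lambda>q. \<eta> q (Y q)) - Y p (\<lambda>q. \<eta> q (X q)) - \<eta> p (lie_bracket X Y p))"

definition fundamental_form :: "'a \<Rightarrow> 'a tangent \<Rightarrow> 'a tangent \<Rightarrow> real" where
  "fundamental_form p u v = g p u (\<phi> p v)"

definition contact_metric :: bool where
  "contact_metric \<longleftrightarrow> (\<forall>U X Y. vector_field_on U X \<longrightarrow> vector_field_on U Y \<longrightarrow>
     (\<forall>p\<in>U. deta X Y p = fundamental_form p (X p) (Y p)))"

text \<open>Sections of \<open>D = ker \<eta>\<close>. Endomorphisms of \<open>D\<close> are represented by their action on local
  sections of \<open>D\<close>; \<open>J\<close> is the endomorphism of \<open>D\<close> induced by \<open>\<phi>\<close>, and the same
  operator also serves for applying \<open>\<phi>\<close> to arbitrary vector fields.\<close>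

definition D_section_on :: "'a set \<Rightarrow> 'a vfield \<Rightarrow> bool" where
  "D_section_on U Y \<longleftrightarrow> vector_field_on U Y \<and> (\<forall>p\<in>U. \<eta> p (Y p) = 0)"

definition proj_D :: "'a vfield \<Rightarrow> 'a vfield" where
  "proj_D X = (\<lambda>p. X p - \<eta> p (X p) *\<^sub>R \<xi> p)"

definition J :: "'a vfield \<Rightarrow> 'a vfield" where
  "J X = (\<lambda>p. \<phi> p (X p))"

definition nabla2 :: "'a vfield \<Rightarrow> 'a vfield \<Rightarrow> 'a vfield \<Rightarrow> 'a vfield" where
  "nabla2 X Y Z = \<nabla> X (\<nabla> Y Z) - \<nabla> (\<nabla> X Y) Z"

definition curvature :: "'a vfield \<Rightarrow> 'a vfield \<Rightarrow> 'a vfield \<Rightarrow> 'a vfield" where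
  "curvature X Y Z = nabla2 X Y Z - nabla2 Y X Z"

definition nabla_bar :: "'a vfield \<Rightarrow> 'a vfield \<Rightarrow> 'a vfield" where
  "nabla_bar X Y = proj_D (\<nabla> X Y)"

definition nabla_bar_End :: "'a vfield \<Rightarrow> ('a vfield \<Rightarrow> 'a vfield) \<Rightarrow> 'a vfield \<Rightarrow> 'a vfield" where
  "nabla_bar_End X A = (\<lambda>Y. nabla_bar X (A Y) - A (nabla_bar X Y))"

definition nabla_bar2_End ::
  "'a vfield \<Rightarrow> 'a vfield \<Rightarrow> ('a vfield \<Rightarrow> 'a vfield) \<Rightarrow> 'a vfield \<Rightarrow> 'a vfield" where
  "nabla_bar2_End X Y A = nabla_bar_End X (nabla_bar_End Y A) - nabla_bar_End (\<nabla> X Y) A"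

text \<open>The following quantities are evaluated with respect to a local orthonormal frame \<open>E\<close>; their
  values on its domain do not depend on the choice of \<open>E\<close>. Local orthonormal frames exist around
  every point (Gram-Schmidt), so quantifying over all of them below covers every point of \<open>M\<close>.\<close>

definition laplacian_xi :: "(nat \<Rightarrow> 'a vfield) \<Rightarrow> 'a vfield" where
  "laplacian_xi E = - (\<Sum>i<DIM('e). nabla2 (E i) (E i) \<xi>)"

definition laplacian_J :: "(nat \<Rightarrow> 'a vfield) \<Rightarrow> 'a vfield \<Rightarrow> 'a vfield" where
  "laplacian_J E = - (\<Sum>i<DIM('e). nabla_bar2_End (E i) (E i) J)"

definition norm2_nabla_xi :: "(nat \<Rightarrow> 'a vfield) \<Rightarrow> 'a \<Rightarrow> real" where
  "norm2_nabla_xi E p = (\<Sum>i<DIM('e). g p (\<nabla> (E i) \<xi> p) (\<nabla> (E i) \<xi> p))"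

definition tau_xi :: "(nat \<Rightarrow> 'a vfield) \<Rightarrow> 'a vfield" where
  "tau_xi E = laplacian_xi E - norm2_nabla_xi E \<cdot> \<xi>"

definition tau_J :: "(nat \<Rightarrow> 'a vfield) \<Rightarrow> 'a vfield \<Rightarrow> 'a vfield" where
  "tau_J E = (\<lambda>Y. laplacian_J E (J Y) - J (laplacian_J E Y))"

definition T_phi :: "(nat \<Rightarrow> 'a vfield) \<Rightarrow> 'a vfield" where
  "T_phi E = (\<Sum>i<DIM('e). nabla_bar_End (E i) J (\<nabla> (E i) \<xi>))"

definition rho_star :: "(nat \<Rightarrow> 'a vfield) \<Rightarrow> 'a vfield \<Rightarrow> 'a vfield \<Rightarrow> 'a \<Rightarrow> real" where
  "rho_star E X Y p = (\<Sum>i<DIM('e). g p (curvature X (E i) (J (E i)) p) (J Y p))"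

definition harmonic :: bool where
  "harmonic \<longleftrightarrow> (\<forall>U E. orthonormal_frame_on U E \<longrightarrow>
     (\<forall>p\<in>U. (tau_xi E + (1/2) *\<^sub>R J (T_phi E)) p = 0) \<and>
     (\<forall>Y. D_section_on U Y \<longrightarrow> (\<forall>p\<in>U. tau_J E Y p = 0)))"

definition harmonic_unit_xi :: bool where
  "harmonic_unit_xi \<longleftrightarrow> (\<forall>U E. orthonormal_frame_on U E \<longrightarrow> (\<forall>p\<in>U. tau_xi E p = 0))"

definition H_contact :: bool where
  "H_contact \<longleftrightarrow> contact_metric \<and> harmonic_unit_xi"

text \<open>The value of \<open>rho_star E X Y\<close> at \<open>p\<close> only depends on \<open>X p\<close> and \<open>Y p\<close>, and every tangent
  vector extends to a local vector field.\<close>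

definition rho_star_symmetric :: bool where
  "rho_star_symmetric \<longleftrightarrow> (\<forall>U E X Y. orthonormal_frame_on U E \<longrightarrow>
     vector_field_on U X \<longrightarrow> vector_field_on U Y \<longrightarrow>
     (\<forall>p\<in>U. rho_star E X Y p = rho_star E Y X p))"

end

end

theory Submission
  imports Defs
begin

text \<open>Let \<open>A = \<nabla>\<xi>\<close> and \<open>S(X,Y) = \<Sum>\<^sub>i g(R(X,E\<^sub>i)\<phi>E\<^sub>i, Y)\<close>, so that \<open>\<rho>\<^sup>*(X,Y) = S(X,\<phi>Y)\<close>; the first Bianchi identity
  makes \<open>S\<close> skew. Since \<open>d\<eta> = \<Phi>\<close>, the form \<open>\<Phi>\<close> is closed and \<open>\<Sum>\<^sub>i (\<nabla>\<^bsub>E\<^sub>i\<^esub>\<phi>)E\<^sub>i = 2n\<xi>\<close>.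
  Differentiating the closedness relation, tracing it and commuting derivatives yields a
  Weitzenboeck formula: up to the term \<open>- 4n\<Phi>(X,Y)\<close>, the trace of \<open>\<nabla>\<^sup>2\<Phi>\<close> at \<open>(X,Y)\<close> is
  \<open>2S(X,Y) - Ric(X,\<phi>Y) + Ric(Y,\<phi>X)\<close> with
  \<open>Ric(X,Y) = \<Sum>\<^sub>i g(R(E\<^sub>i,X)E\<^sub>i, Y)\<close>.
  On \<open>D\<close> all terms except \<open>S\<close> commute with \<open>J\<close>, and so do the terms quadratic in \<open>A\<close> by which the
  Laplacian of \<open>J\<close> differs from that of \<open>\<phi>\<close>. Hence \<open>\<tau>(J) = 0\<close> if and only if \<open>\<rho>\<^sup>*\<close> is symmetric on \<open>D\<close>.
  Evaluated at \<open>Y = \<xi>\<close>, where \<open>\<tau>(\<xi>) = 0\<close> removes the Ricci term, the formula shows that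
  \<open>J T(\<phi>) = 0\<close> if and only if \<open>\<rho>\<^sup>*(\<xi>,\<cdot>) = 0\<close>, while \<open>\<rho>\<^sup>*(\<cdot>,\<xi>) = 0\<close> always holds.\<close>

section \<open>Smooth functions and vector fields\<close>

lemma sum_apply: "(\<Sum>i\<in>I. (f i :: 'b \<Rightarrow> 'c::comm_monoid_add)) x = (\<Sum>i\<in>I. f i x)"
  by (induction I rule: infinite_finite_induct) auto

lemma fscale_add_right: "f \<cdot> (X + Y) = f \<cdot> X + f \<cdot> Y"
  and fscale_add_left: "(f + h) \<cdot> X = f \<cdot> X + h \<cdot> X"
  and fscale_fscale: "f \<cdot> h \<cdot> X = (f * h) \<cdot> X"
  by (auto simp: fscale_def fun_eq_iff scaleR_add_left scaleR_add_right)

section \<open>Functions of class C^k on open subsets of a Euclidean space\<close>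

lemma Ck_on_subset: "Ck_on k f S \<Longrightarrow> T \<subseteq> S \<Longrightarrow> Ck_on k f T"
  by (induction k arbitrary: f) (auto intro: continuous_on_subset)

text \<open>At a point of the open set \<open>S\<close> the derivative depends only on the values of
  the function on \<open>S\<close>, so agreement on \<open>S\<close> passes to the derivatives and
  the induction goes through.\<close>

lemma Ck_on_cong:
  assumes "open S" "\<And>x. x \<in> S \<Longrightarrow> f x = h x" "Ck_on k f S"
  shows "Ck_on k h S"
  using assms(2,3)
proof (induction k arbitrary: f h)
  case 0
  then show ?case using continuous_on_cong[of S S f h] by simp
next
  case (Suc k)
  have der: "(h has_derivative frechet_derivative f (at x)) (at x)" if "x \<in> S" for x
  proof (rule has_derivative_transform_within_open[OF _ assms(1) that])
    show "(f has_derivative frechet_derivative f (at x)) (at x)"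
      using Suc.prems(2) that by (simp add: frechet_derivative_works[symmetric])
  qed (use Suc.prems in auto)
  have "Ck_on k (\<lambda>x. frechet_derivative h (at x) v) S" for v
  proof (rule Suc.IH)
    show "Ck_on k (\<lambda>x. frechet_derivative f (at x) v) S"
      using Suc.prems(2) by simp
    show "frechet_derivative f (at x) v = frechet_derivative h (at x) v" if "x \<in> S" for x
      using frechet_derivative_at[OF der[OF that]] by simp
  qed
  then show ?case using der by (auto simp: differentiable_def)
qed

lemma Ck_on_SucD: "Ck_on (Suc k) f S \<Longrightarrow> Ck_on k f S"
proof (induction k arbitrary: f)
  case 0
  then show ?case
    by (auto intro!: continuous_at_imp_continuous_on differentiable_imp_continuous_within)
qed auto

lemma Ck_on_const: "Ck_on k (\<lambda>_. a) S"
  by (induction k arbitrary: a) auto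

lemma Ck_on_add:
  assumes "open S" "Ck_on k f S" "Ck_on k h S"
  shows "Ck_on k (\<lambda>x. f x + h x) S"
  using assms(2,3)
proof (induction k arbitrary: f h)
  case (Suc k)
  have der: "((\<lambda>x. f x + h x) has_derivative
      (\<lambda>v. frechet_derivative f (at x) v + frechet_derivative h (at x) v)) (at x)" if "x \<in> S" for x
    using Suc.prems that by (auto intro!: derivative_intros simp: frechet_derivative_works[symmetric])
  have "Ck_on k (\<lambda>x. frechet_derivative (\<lambda>x. f x + h x) (at x) v) S" for v
    by (rule Ck_on_cong[OF assms(1), of "\<lambda>x. frechet_derivative f (at x) v + frechet_derivative h (at x) v"])
      (use Suc der in \<open>auto simp: frechet_derivative_at[OF der, symmetric]\<close>)
  then show ?case using der by (auto simp: differentiable_def)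
qed (auto intro: continuous_intros)

lemma Ck_on_mult:
  fixes f h :: "'e::euclidean_space \<Rightarrow> real"
  assumes "open S" "Ck_on k f S" "Ck_on k h S"
  shows "Ck_on k (\<lambda>x. f x * h x) S"
  using assms(2,3)
proof (induction k arbitrary: f h)
  case (Suc k)
  \<comment> \<open>The Leibniz rule leaves one factor of each product undifferentiated; the
    induction hypothesis applies to it only after it is lowered to class C^k.\<close>
  have lower: "Ck_on k f S" "Ck_on k h S"
    using Suc.prems Ck_on_SucD by blast+
  have der: "((\<lambda>x. f x * h x) has_derivative
      (\<lambda>v. f x * frechet_derivative h (at x) v + frechet_derivative f (at x) v * h x)) (at x)"
    if "x \<in> S" for x
    using Suc.prems that
    by (intro has_derivative_mult) (auto simp: frechet_derivative_works[symmetric])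
  have "Ck_on k (\<lambda>x. f x * frechet_derivative h (at x) v + frechet_derivative f (at x) v * h x) S" for v
    using Suc.prems by (intro Ck_on_add assms(1) Suc.IH lower) auto
  then have "Ck_on k (\<lambda>x. frechet_derivative (\<lambda>x. f x * h x) (at x) v) S" for v
    by (rule Ck_on_cong[OF assms(1), rotated]) (simp add: frechet_derivative_at[OF der, symmetric])
  then show ?case using der by (auto simp: differentiable_def)
qed (auto intro: continuous_intros)

context smooth_manifold
begin

section \<open>Smooth functions on the manifold, read in charts\<close>

lemma chart_inj_on:
  assumes "(V, x) \<in> charts"
  shows "inj_on x V"
proof -
  have "topspace (subtopology M V) = V"
    using chart_homeo[OF assms] openin_subset by (auto simp: topspace_subtopology)
  then show ?thesis
    using chart_homeo[OF assms] homeomorphic_imp_injective_map by metis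
qed

lemma chart_open_image:
  assumes "(V, x) \<in> charts" "openin M U"
  shows "open (x ` (V \<inter> U))"
proof -
  have "openin (subtopology M V) (V \<inter> U)"
    using assms(2) by (auto simp: openin_subtopology)
  then have "openin (top_of_set (x ` V)) (x ` (V \<inter> U))"
    using chart_homeo[OF assms(1)] homeomorphic_imp_open_map unfolding open_map_def by blast
  then show ?thesis
    using chart_homeo[OF assms(1)] openin_open_trans by blast
qed

lemma smooth_fun_on_subset:
  "smooth_fun_on U f \<Longrightarrow> openin M W \<Longrightarrow> W \<subseteq> U \<Longrightarrow> smooth_fun_on W f"
  unfolding smooth_fun_on_def smooth_on_def
  by (fastforce intro: Ck_on_subset[OF _ image_mono])

text \<open>Openness of the chart image is offered as a premise because the closure rules for
  \<open>Ck_on\<close> ask for it.\<close>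

lemma smooth_fun_onI:
  assumes "openin M U"
    and "\<And>V x k. (V, x) \<in> charts \<Longrightarrow> open (x ` (V \<inter> U)) \<Longrightarrow>
      Ck_on k (f \<circ> inv_into V x) (x ` (V \<inter> U))"
  shows "smooth_fun_on U f"
  using assms chart_open_image[OF _ assms(1)] unfolding smooth_fun_on_def smooth_on_def by auto

lemma smooth_fun_onD:
  "smooth_fun_on U f \<Longrightarrow> (V, x) \<in> charts \<Longrightarrow> Ck_on k (f \<circ> inv_into V x) (x ` (V \<inter> U))"
  unfolding smooth_fun_on_def smooth_on_def by auto

lemma smooth_fun_on_openin: "smooth_fun_on U f \<Longrightarrow> openin M U"
  by (simp add: smooth_fun_on_def)

lemma smooth_fun_on_cong:
  assumes "smooth_fun_on U f" "\<And>p. p \<in> U \<Longrightarrow> f p = h p"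
  shows "smooth_fun_on U h"
proof (rule smooth_fun_onI[OF smooth_fun_on_openin[OF assms(1)]])
  fix V x k assume V: "(V, x) \<in> charts" "open (x ` (V \<inter> U))"
  show "Ck_on k (h \<circ> inv_into V x) (x ` (V \<inter> U))"
    by (rule Ck_on_cong[OF V(2) _ smooth_fun_onD[OF assms(1) V(1)]])
      (auto simp: inv_into_f_f[OF chart_inj_on[OF V(1)]] assms(2))
qed

lemma smooth_fun_on_const: "openin M U \<Longrightarrow> smooth_fun_on U (\<lambda>_. a)"
  by (rule smooth_fun_onI) (auto simp: o_def Ck_on_const)

lemma smooth_fun_on_add:
  assumes "smooth_fun_on U f" "smooth_fun_on U h"
  shows "smooth_fun_on U (f + h)"
proof (rule smooth_fun_onI[OF smooth_fun_on_openin[OF assms(1)]])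
  fix V x k assume "(V, x) \<in> charts" "open (x ` (V \<inter> U))"
  then show "Ck_on k (f + h \<circ> inv_into V x) (x ` (V \<inter> U))"
    using Ck_on_add[OF _ smooth_fun_onD smooth_fun_onD] assms by (auto simp: o_def)
qed

lemma smooth_fun_on_mult:
  assumes "smooth_fun_on U f" "smooth_fun_on U h"
  shows "smooth_fun_on U (f * h)"
proof (rule smooth_fun_onI[OF smooth_fun_on_openin[OF assms(1)]])
  fix V x k assume "(V, x) \<in> charts" "open (x ` (V \<inter> U))"
  then show "Ck_on k (f * h \<circ> inv_into V x) (x ` (V \<inter> U))"
    using Ck_on_mult[OF _ smooth_fun_onD smooth_fun_onD] assms by (auto simp: o_def)
qed

lemma smooth_fun_on_scaleR: "smooth_fun_on U f \<Longrightarrow> smooth_fun_on U (a *\<^sub>R f)"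
  using smooth_fun_on_mult[OF smooth_fun_on_const[OF smooth_fun_on_openin, of U f a]]
  by (simp add: scaleR_fun_def times_fun_def)

lemma smooth_fun_on_uminus: "smooth_fun_on U f \<Longrightarrow> smooth_fun_on U (- f)"
  using smooth_fun_on_scaleR[of U f "-1"] by simp

lemma smooth_fun_on_diff: "smooth_fun_on U f \<Longrightarrow> smooth_fun_on U h \<Longrightarrow> smooth_fun_on U (f - h)"
  using smooth_fun_on_add[of U f "- h"] smooth_fun_on_uminus[of U h] by simp

lemma smooth_fun_near: "smooth_fun_on U f \<Longrightarrow> p \<in> U \<Longrightarrow> smooth_fun_near p f"
  unfolding smooth_fun_near_def by auto

section \<open>Tangent vectors as derivations\<close>

lemma tangent_add: "v \<in> tangent_space p \<Longrightarrow> smooth_fun_near p f \<Longrightarrow> smooth_fun_near p h \<Longrightarrow>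
    v (f + h) = v f + v h"
  and tangent_mult: "v \<in> tangent_space p \<Longrightarrow> smooth_fun_near p f \<Longrightarrow> smooth_fun_near p h \<Longrightarrow>
    v (f * h) = f p * v h + h p * v f"
  and tangent_scaleR: "v \<in> tangent_space p \<Longrightarrow> smooth_fun_near p f \<Longrightarrow> v (a *\<^sub>R f) = a * v f"
  unfolding tangent_space_def by auto

lemma tangent_diff:
  assumes "v \<in> tangent_space p" "smooth_fun_on U f" "smooth_fun_on U h" "p \<in> U"
  shows "v (f - h) = v f - v h"
proof -
  have "v (f + (- 1) *\<^sub>R h) = v f + (- 1) * v h"
    using assms smooth_fun_near[OF smooth_fun_on_scaleR] smooth_fun_near
    by (metis tangent_add tangent_scaleR)
  then show ?thesis by simp
qed

lemma tangent_local:
  assumes v: "v \<in> tangent_space p" and f: "smooth_fun_on U f" and p: "p \<in> U"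
    and eq: "\<And>q. q \<in> U \<Longrightarrow> f q = h q"
  shows "v f = v h"
proof -
  \<comment> \<open>\<open>e\<close> is idempotent, so \<open>v\<close> kills it, and \<open>e * f = e * h\<close>.\<close>
  define e :: "'a \<Rightarrow> real" where "e = (\<lambda>q. if q \<in> U then 1 else 0)"
  have e: "smooth_fun_near p e"
    using smooth_fun_on_cong[OF smooth_fun_on_const[OF smooth_fun_on_openin[OF f]], of 1 e] p
    by (intro smooth_fun_near[of U]) (auto simp: e_def)
  have "e * e = e" by (auto simp: e_def)
  then have "v e = 0"
    using tangent_mult[OF v e e] p by (simp add: e_def)
  moreover have "e p = 1" using p by (simp add: e_def)
  ultimately have mult: "v (e * k) = v k" if "smooth_fun_near p k" for k
    using tangent_mult[OF v e that] by simp
  have "e * f = e * h" using eq by (auto simp: e_def)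
  moreover have "smooth_fun_near p f" "smooth_fun_near p h"
    using smooth_fun_near smooth_fun_on_cong[OF f] f p eq by blast+
  ultimately show ?thesis by (metis mult)
qed

text \<open>The product rule for \<open>1 * 1\<close> gives \<open>v 1 = v 1 + v 1\<close>, and
  \<open>v\<close> is homogeneous.\<close>

lemma tangent_const: "v \<in> tangent_space p \<Longrightarrow> p \<in> topspace M \<Longrightarrow> v (\<lambda>_. a) = 0"
proof -
  assume v: "v \<in> tangent_space p" "p \<in> topspace M"
  have "smooth_fun_near p 1"
    using smooth_fun_near[OF smooth_fun_on_const[OF openin_topspace] v(2), of 1] by (simp add: one_fun_def)
  then have "v 1 = 0" "v (a *\<^sub>R 1) = a * v 1"
    using tangent_mult[OF v(1), of 1 1] tangent_scaleR[OF v(1), of 1 a] by auto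
  moreover have "a *\<^sub>R 1 = (\<lambda>_::'a. a)" by (auto simp: scaleR_fun_def)
  ultimately show ?thesis by simp
qed

lemma subspace_tangent_space: "subspace (tangent_space p)"
  unfolding subspace_def tangent_space_def by (auto simp: scaleR_fun_def algebra_simps)

lemmas tangent_space_add = subspace_add[OF subspace_tangent_space]
  and tangent_space_scaleR = subspace_scale[OF subspace_tangent_space]
  and tangent_space_zero = subspace_0[OF subspace_tangent_space]
  and tangent_space_uminus = subspace_neg[OF subspace_tangent_space]

section \<open>Vector fields and the Lie bracket\<close>

lemma vector_field_onI:
  assumes "openin M U" "\<And>p. p \<in> U \<Longrightarrow> X p \<in> tangent_space p"
    and "\<And>W f. W \<subseteq> U \<Longrightarrow> smooth_fun_on W f \<Longrightarrow> smooth_fun_on W (\<lambda>p. X p f)"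
  shows "vector_field_on U X"
  using assms unfolding vector_field_on_def by blast

lemma vector_field_on_openin: "vector_field_on U X \<Longrightarrow> openin M U"
  and vector_field_on_tangent: "vector_field_on U X \<Longrightarrow> p \<in> U \<Longrightarrow> X p \<in> tangent_space p"
  and vector_field_on_smooth:
    "vector_field_on U X \<Longrightarrow> W \<subseteq> U \<Longrightarrow> smooth_fun_on W f \<Longrightarrow> smooth_fun_on W (\<lambda>p. X p f)"
  unfolding vector_field_on_def by auto

lemma vector_field_on_cong:
  assumes "vector_field_on U X" "\<And>p. p \<in> U \<Longrightarrow> X p = Y p"
  shows "vector_field_on U Y"
proof (rule vector_field_onI[OF vector_field_on_openin[OF assms(1)]])
  show "Y p \<in> tangent_space p" if "p \<in> U" for p
    using vector_field_on_tangent[OF assms(1) that] assms(2)[OF that] by simp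
  show "smooth_fun_on W (\<lambda>p. Y p f)" if "W \<subseteq> U" "smooth_fun_on W f" for W f
    using vector_field_on_smooth[OF assms(1) that] that(1) assms(2)
    by (elim smooth_fun_on_cong) (metis subsetD)
qed

lemma vector_field_on_subset: "vector_field_on U X \<Longrightarrow> openin M W \<Longrightarrow> W \<subseteq> U \<Longrightarrow> vector_field_on W X"
  unfolding vector_field_on_def by blast

lemma vector_field_on_zero: "openin M U \<Longrightarrow> vector_field_on U 0"
  using smooth_fun_on_const smooth_fun_on_openin
  by (intro vector_field_onI) (auto simp: tangent_space_zero)

lemma vector_field_on_add:
  assumes "vector_field_on U X" "vector_field_on U Y"
  shows "vector_field_on U (X + Y)"
proof (rule vector_field_onI[OF vector_field_on_openin[OF assms(1)]])
  show "(X + Y) p \<in> tangent_space p" if "p \<in> U" for p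
    using assms that by (simp add: tangent_space_add vector_field_on_tangent)
  show "smooth_fun_on W (\<lambda>p. (X + Y) p f)" if "W \<subseteq> U" "smooth_fun_on W f" for W f
    using smooth_fun_on_add[OF assms[THEN vector_field_on_smooth, OF that]] by (simp add: plus_fun_def)
qed

lemma vector_field_on_fscale:
  assumes "smooth_fun_on U f" "vector_field_on U X"
  shows "vector_field_on U (f \<cdot> X)"
proof (rule vector_field_onI[OF vector_field_on_openin[OF assms(2)]])
  show "(f \<cdot> X) p \<in> tangent_space p" if "p \<in> U" for p
    using assms(2) that by (simp add: fscale_def tangent_space_scaleR vector_field_on_tangent)
  show "smooth_fun_on W (\<lambda>p. (f \<cdot> X) p h)" if "W \<subseteq> U" "smooth_fun_on W h" for W h
    using smooth_fun_on_mult[OF smooth_fun_on_subset[OF assms(1) smooth_fun_on_openin[OF that(2)] that(1)]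
        vector_field_on_smooth[OF assms(2) that]]
    by (simp add: times_fun_def fscale_def scaleR_fun_def)
qed

lemma vector_field_on_uminus: "vector_field_on U X \<Longrightarrow> vector_field_on U (- X)"
  using vector_field_on_fscale[OF smooth_fun_on_const[OF vector_field_on_openin], of U X X "- 1"]
  by (auto simp: fscale_def fun_Compl_def elim!: vector_field_on_cong)

lemma vector_field_on_diff:
  "vector_field_on U X \<Longrightarrow> vector_field_on U Y \<Longrightarrow> vector_field_on U (X - Y)"
  using vector_field_on_add[of U X "- Y"] vector_field_on_uminus[of U Y] by simp

text \<open>The Jacobi identity: after expansion each composition of three derivations occurs twice,
  with opposite signs. The inner brackets are represented by fields that agree with them on
  \<open>W\<close> only, so that cut-off versions can be inserted later.\<close>

lemma lie_bracket_cyclic: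
  assumes X: "vector_field_on W X" and Y: "vector_field_on W Y" and Z: "vector_field_on W Z"
    and p: "p \<in> W"
    and BXY: "\<And>q. q \<in> W \<Longrightarrow> BXY q = lie_bracket X Y q"
    and BYZ: "\<And>q. q \<in> W \<Longrightarrow> BYZ q = lie_bracket Y Z q"
    and BZX: "\<And>q. q \<in> W \<Longrightarrow> BZX q = lie_bracket Z X q"
  shows "lie_bracket X BYZ p + lie_bracket Y BZX p + lie_bracket Z BXY p = 0"
proof
  fix f
  show "(lie_bracket X BYZ p + lie_bracket Y BZX p + lie_bracket Z BXY p) f = 0 f"
  proof (cases "smooth_fun_near p f")
    case True
    then obtain W' where W': "smooth_fun_on W' f" "p \<in> W'"
      unfolding smooth_fun_near_def by blast
    define W0 where "W0 = W \<inter> W'"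
    have W0: "W0 \<subseteq> W" "p \<in> W0" "smooth_fun_on W0 f"
      using W' p smooth_fun_on_subset[OF W'(1)] vector_field_on_openin[OF X]
        smooth_fun_on_openin[OF W'(1)] by (auto simp: W0_def)
    \<comment> \<open>The derivation \<open>A p\<close> sees only values near \<open>p\<close>, so
      the bracket under it may be expanded on \<open>W0\<close>, where \<open>f\<close> is smooth
      and all fields are defined.\<close>
    have act: "A p (\<lambda>q. BBC q f) = A p (\<lambda>q. B q (\<lambda>r. C r f)) - A p (\<lambda>q. C q (\<lambda>r. B r f))"
      if A: "vector_field_on W A" and B: "vector_field_on W B" and C: "vector_field_on W C"
        and BC: "\<And>q. q \<in> W \<Longrightarrow> BBC q = lie_bracket B C q" for A B C BBC
    proof -
      have BCf: "smooth_fun_on W0 (\<lambda>q. B q (\<lambda>r. C r f))" "smooth_fun_on W0 (\<lambda>q. C q (\<lambda>r. B r f))"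
        using vector_field_on_smooth[OF B W0(1)] vector_field_on_smooth[OF C W0(1)] W0(3) by blast+
      have T: "A p \<in> tangent_space p"
        using vector_field_on_tangent[OF A p] .
      have "A p ((\<lambda>q. B q (\<lambda>r. C r f)) - (\<lambda>q. C q (\<lambda>r. B r f))) = A p (\<lambda>q. BBC q f)"
      proof (rule tangent_local[OF T smooth_fun_on_diff[OF BCf] W0(2)])
        fix q assume "q \<in> W0"
        then show "((\<lambda>q. B q (\<lambda>r. C r f)) - (\<lambda>q. C q (\<lambda>r. B r f))) q = BBC q f"
          using W0 BC[of q] smooth_fun_near[OF W0(3)] by (auto simp: lie_bracket_def)
      qed
      then show ?thesis
        using tangent_diff[OF T BCf W0(2)] by simp
    qed
    have "smooth_fun_near p (\<lambda>q. A q f)" if "vector_field_on W A" for A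
      using smooth_fun_near[OF vector_field_on_smooth[OF that W0(1,3)] W0(2)] .
    then show ?thesis
      using True X Y Z act[OF X Y Z BYZ] act[OF Y Z X BZX] act[OF Z X Y BXY]
        BXY[OF p] BYZ[OF p] BZX[OF p]
      by (simp add: lie_bracket_def)
  qed (simp add: lie_bracket_def)
qed

end

section \<open>Tensor calculus over a framed open set\<close>

text \<open>\<open>V\<close> and \<open>F\<close> stand for the vector fields and the smooth functions over the domain of the frame
  \<open>E\<close>, and \<open>d X f\<close> is the derivative of \<open>f\<close> along \<open>X\<close>. Orthonormality of \<open>E\<close> enters only through
  the last two assumptions.\<close>

locale framed_levi_civita =
  fixes V :: "'v::ab_group_add set"
    and F :: "'f::comm_ring_1 set"
    and sm :: "'f \<Rightarrow> 'v \<Rightarrow> 'v"  (infixr "\<odot>" 75)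
    and ip :: "'v \<Rightarrow> 'v \<Rightarrow> 'f"
    and nb :: "'v \<Rightarrow> 'v \<Rightarrow> 'v"
    and d :: "'v \<Rightarrow> 'f \<Rightarrow> 'f"
    and N :: nat
    and E :: "nat \<Rightarrow> 'v"
  assumes twice_zero: "f + f = 0 \<Longrightarrow> f = (0::'f)"
    and F_add [simp]: "f \<in> F \<Longrightarrow> h \<in> F \<Longrightarrow> f + h \<in> F"
    and F_mult [simp]: "f \<in> F \<Longrightarrow> h \<in> F \<Longrightarrow> f * h \<in> F"
    and F_uminus [simp]: "f \<in> F \<Longrightarrow> - f \<in> F"
    and V_zero [simp]: "0 \<in> V"
    and V_add [simp]: "X \<in> V \<Longrightarrow> Y \<in> V \<Longrightarrow> X + Y \<in> V"
    and V_sm [simp]: "f \<in> F \<Longrightarrow> X \<in> V \<Longrightarrow> f \<odot> X \<in> V"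
    and V_uminus [simp]: "X \<in> V \<Longrightarrow> - X \<in> V"
    and V_nb [simp]: "X \<in> V \<Longrightarrow> Y \<in> V \<Longrightarrow> nb X Y \<in> V"
    and F_ip [simp]: "X \<in> V \<Longrightarrow> Y \<in> V \<Longrightarrow> ip X Y \<in> F"
    and F_d [simp]: "X \<in> V \<Longrightarrow> f \<in> F \<Longrightarrow> d X f \<in> F"
    and sm_add_right: "f \<odot> (X + Y) = f \<odot> X + f \<odot> Y"
    and sm_add_left: "(f + h) \<odot> X = f \<odot> X + h \<odot> X"
    and sm_sm: "f \<odot> h \<odot> X = (f * h) \<odot> X"
    and ip_add_left: "X \<in> V \<Longrightarrow> Y \<in> V \<Longrightarrow> Z \<in> V \<Longrightarrow> ip (X + Y) Z = ip X Z + ip Y Z"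
    and ip_sm_left: "f \<in> F \<Longrightarrow> X \<in> V \<Longrightarrow> Z \<in> V \<Longrightarrow> ip (f \<odot> X) Z = f * ip X Z"
    and ip_commute: "X \<in> V \<Longrightarrow> Y \<in> V \<Longrightarrow> ip X Y = ip Y X"
    and d_add: "X \<in> V \<Longrightarrow> f \<in> F \<Longrightarrow> h \<in> F \<Longrightarrow> d X (f + h) = d X f + d X h"
    and d_mult: "X \<in> V \<Longrightarrow> f \<in> F \<Longrightarrow> h \<in> F \<Longrightarrow> d X (f * h) = f * d X h + h * d X f"
    and d_bracket: "X \<in> V \<Longrightarrow> Y \<in> V \<Longrightarrow> f \<in> F \<Longrightarrow>
        d (nb X Y - nb Y X) f = d X (d Y f) - d Y (d X f)"
    and Jacobi: "X \<in> V \<Longrightarrow> Y \<in> V \<Longrightarrow> Z \<in> V \<Longrightarrow>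
        (let br = (\<lambda>X Y. nb X Y - nb Y X) in
          br X (br Y Z) + br Y (br Z X) + br Z (br X Y) = 0)"
    and nb_add_left: "X \<in> V \<Longrightarrow> Y \<in> V \<Longrightarrow> Z \<in> V \<Longrightarrow> nb (X + Y) Z = nb X Z + nb Y Z"
    and nb_add_right: "X \<in> V \<Longrightarrow> Y \<in> V \<Longrightarrow> Z \<in> V \<Longrightarrow> nb X (Y + Z) = nb X Y + nb X Z"
    and nb_sm_left: "f \<in> F \<Longrightarrow> X \<in> V \<Longrightarrow> Y \<in> V \<Longrightarrow> nb (f \<odot> X) Y = f \<odot> nb X Y"
    and nb_sm_right: "f \<in> F \<Longrightarrow> X \<in> V \<Longrightarrow> Y \<in> V \<Longrightarrow>
        nb X (f \<odot> Y) = d X f \<odot> Y + f \<odot> nb X Y"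
    and nb_metric: "X \<in> V \<Longrightarrow> Y \<in> V \<Longrightarrow> Z \<in> V \<Longrightarrow>
        d X (ip Y Z) = ip (nb X Y) Z + ip Y (nb X Z)"
    and E_V [simp]: "i < N \<Longrightarrow> E i \<in> V"
    and d_ip_E: "X \<in> V \<Longrightarrow> i < N \<Longrightarrow> j < N \<Longrightarrow> d X (ip (E i) (E j)) = 0"
    and E_expand: "X \<in> V \<Longrightarrow> X = (\<Sum>i<N. ip X (E i) \<odot> E i)"
begin

section \<open>Linear rules for the abstract operations\<close>

lemma V_diff [simp]: "X \<in> V \<Longrightarrow> Y \<in> V \<Longrightarrow> X - Y \<in> V"
  using V_add[of X "- Y"] by simp

lemma F_diff [simp]: "f \<in> F \<Longrightarrow> h \<in> F \<Longrightarrow> f - h \<in> F"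
  using F_add[of f "- h"] by simp

lemma F_zero [simp]: "0 \<in> F"
  using F_diff[OF F_ip F_ip, OF V_zero V_zero V_zero V_zero] by simp

lemma V_sum [simp]: "(\<And>i. i < n \<Longrightarrow> W i \<in> V) \<Longrightarrow> (\<Sum>i<n. W i) \<in> V"
  for n :: nat
  by (induction n) auto

lemma F_sum [simp]: "(\<And>i. i < n \<Longrightarrow> W i \<in> F) \<Longrightarrow> (\<Sum>i<n. W i) \<in> F"
  for n :: nat
  by (induction n) auto

text \<open>The abstract function ring provides no inverse of 2; this cancellation takes the place
  of halving.\<close>

lemma twice_cancel: "a + a = b + b \<Longrightarrow> a = (b::'f)"
  using twice_zero[of "a - b"] by (simp add: algebra_simps)

lemma sm_zero_right [simp]: "f \<odot> 0 = 0"
  using sm_add_right[of f 0 0] by simp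

lemma sm_zero_left [simp]: "0 \<odot> X = 0"
  using sm_add_left[of 0 0 X] by simp

lemma sm_minus_right: "f \<odot> (- X) = - (f \<odot> X)"
  using sm_add_right[of f X "- X"] by (simp add: eq_neg_iff_add_eq_0 add.commute)

lemma sm_minus_left: "(- f) \<odot> X = - (f \<odot> X)"
  using sm_add_left[of f "- f" X] by (simp add: eq_neg_iff_add_eq_0 add.commute)

lemma sm_diff_right: "f \<odot> (X - Y) = f \<odot> X - f \<odot> Y"
  using sm_add_right[of f X "- Y"] by (simp add: sm_minus_right)

lemma sm_diff_left: "(f - h) \<odot> X = f \<odot> X - h \<odot> X"
  using sm_add_left[of f "- h" X] by (simp add: sm_minus_left)

lemma ip_add_right: "X \<in> V \<Longrightarrow> Y \<in> V \<Longrightarrow> Z \<in> V \<Longrightarrow> ip Z (X + Y) = ip Z X + ip Z Y"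
  by (simp add: ip_commute[of Z] ip_add_left)

lemma ip_sm_right: "f \<in> F \<Longrightarrow> X \<in> V \<Longrightarrow> Z \<in> V \<Longrightarrow> ip Z (f \<odot> X) = f * ip Z X"
  by (simp add: ip_commute[of Z] ip_sm_left)

lemma ip_zero_left [simp]: "Z \<in> V \<Longrightarrow> ip 0 Z = 0"
  using ip_add_left[of 0 0 Z] by simp

lemma ip_zero_right [simp]: "Z \<in> V \<Longrightarrow> ip Z 0 = 0"
  by (simp add: ip_commute[of Z])

lemma ip_minus_left: "X \<in> V \<Longrightarrow> Z \<in> V \<Longrightarrow> ip (- X) Z = - ip X Z"
  using ip_add_left[of X "- X" Z] by (simp add: eq_neg_iff_add_eq_0 add.commute)

lemma ip_minus_right: "X \<in> V \<Longrightarrow> Z \<in> V \<Longrightarrow> ip Z (- X) = - ip Z X"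
  by (simp add: ip_commute[of Z] ip_minus_left)

lemma ip_diff_left: "X \<in> V \<Longrightarrow> Y \<in> V \<Longrightarrow> Z \<in> V \<Longrightarrow> ip (X - Y) Z = ip X Z - ip Y Z"
  using ip_add_left[of X "- Y" Z] by (simp add: ip_minus_left)

lemma ip_diff_right: "X \<in> V \<Longrightarrow> Y \<in> V \<Longrightarrow> Z \<in> V \<Longrightarrow> ip Z (X - Y) = ip Z X - ip Z Y"
  by (simp add: ip_commute[of Z] ip_diff_left)

lemma ip_sum_left:
  fixes n :: nat
  assumes "\<And>i. i < n \<Longrightarrow> W i \<in> V" and "Z \<in> V"
  shows "ip (\<Sum>i<n. W i) Z = (\<Sum>i<n. ip (W i) Z)"
  using assms by (induction n) (auto simp: ip_add_left)

lemma ip_sum_right: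
  fixes n :: nat
  assumes "\<And>i. i < n \<Longrightarrow> W i \<in> V" and "Z \<in> V"
  shows "ip Z (\<Sum>i<n. W i) = (\<Sum>i<n. ip Z (W i))"
  using assms by (induction n) (auto simp: ip_add_right)

lemma d_zero_right [simp]: "X \<in> V \<Longrightarrow> d X 0 = 0"
  using d_add[of X 0 0] by simp

lemma d_minus: "X \<in> V \<Longrightarrow> f \<in> F \<Longrightarrow> d X (- f) = - d X f"
  using d_add[of X f "- f"] by (simp add: eq_neg_iff_add_eq_0 add.commute)

lemma d_diff: "X \<in> V \<Longrightarrow> f \<in> F \<Longrightarrow> h \<in> F \<Longrightarrow> d X (f - h) = d X f - d X h"
  using d_add[of X f "- h"] by (simp add: d_minus)

lemma d_sum:
  fixes n :: nat
  assumes "\<And>i. i < n \<Longrightarrow> w i \<in> F" and "X \<in> V"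
  shows "d X (\<Sum>i<n. w i) = (\<Sum>i<n. d X (w i))"
  using assms by (induction n) (auto simp: d_add)

lemma nb_zero_left [simp]: "Z \<in> V \<Longrightarrow> nb 0 Z = 0"
  using nb_add_left[of 0 0 Z] by simp

lemma nb_zero_right [simp]: "Z \<in> V \<Longrightarrow> nb Z 0 = 0"
  using nb_add_right[of Z 0 0] by simp

lemma nb_minus_left: "X \<in> V \<Longrightarrow> Z \<in> V \<Longrightarrow> nb (- X) Z = - nb X Z"
  using nb_add_left[of X "- X" Z] by (simp add: eq_neg_iff_add_eq_0 add.commute)

lemma nb_minus_right: "X \<in> V \<Longrightarrow> Z \<in> V \<Longrightarrow> nb Z (- X) = - nb Z X"
  using nb_add_right[of Z X "- X"] by (simp add: eq_neg_iff_add_eq_0 add.commute)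

lemma nb_diff_left: "X \<in> V \<Longrightarrow> Y \<in> V \<Longrightarrow> Z \<in> V \<Longrightarrow> nb (X - Y) Z = nb X Z - nb Y Z"
  using nb_add_left[of X "- Y" Z] by (simp add: nb_minus_left)

lemma nb_diff_right: "X \<in> V \<Longrightarrow> Y \<in> V \<Longrightarrow> Z \<in> V \<Longrightarrow> nb Z (X - Y) = nb Z X - nb Z Y"
  using nb_add_right[of Z X "- Y"] by (simp add: nb_minus_right)

lemma nb_sum_right:
  fixes n :: nat
  assumes "\<And>i. i < n \<Longrightarrow> W i \<in> V" and "Z \<in> V"
  shows "nb Z (\<Sum>i<n. W i) = (\<Sum>i<n. nb Z (W i))"
  using assms by (induction n) (auto simp: nb_add_right)

lemmas sm_expand = sm_add_left sm_add_right sm_diff_left sm_diff_right sm_minus_left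
  sm_minus_right sm_sm
lemmas ip_expand = ip_add_left ip_add_right ip_diff_left ip_diff_right ip_minus_left
  ip_minus_right ip_sm_left ip_sm_right
lemmas nb_expand = nb_add_left nb_add_right nb_diff_left nb_diff_right nb_minus_left
  nb_minus_right nb_sm_left nb_sm_right
text \<open>By \<open>E_expand\<close> a field is recovered from its products with the
  \<open>E i\<close>.\<close>

lemma V_eqI:
  assumes "X \<in> V" "Y \<in> V" and "\<And>Z. Z \<in> V \<Longrightarrow> ip Z X = ip Z Y"
  shows "X = Y"
proof -
  have "ip X (E i) = ip Y (E i)" if "i < N" for i
    using assms(3)[of "E i"] that assms(1,2) by (simp add: ip_commute)
  then have "(\<Sum>i<N. ip X (E i) \<odot> E i) = (\<Sum>i<N. ip Y (E i) \<odot> E i)"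
    by simp
  then show ?thesis
    by (simp only: E_expand[OF assms(1), symmetric] E_expand[OF assms(2), symmetric])
qed

section \<open>Traces over the frame\<close>

definition tensorial :: "('v \<Rightarrow> 'f) \<Rightarrow> bool" where
  "tensorial L \<longleftrightarrow> (\<forall>X\<in>V. \<forall>Y\<in>V. L (X + Y) = L X + L Y) \<and>
     (\<forall>f\<in>F. \<forall>X\<in>V. L (f \<odot> X) = f * L X)"

lemma tensorial_expand:
  assumes "tensorial L" "X \<in> V"
  shows "L X = (\<Sum>i<N. ip X (E i) * L (E i))"
proof -
  have zero: "L 0 = 0"
    using assms(1) V_zero unfolding tensorial_def by (metis add.right_neutral add_cancel_left_left)
  have "L (\<Sum>i<n. ip X (E i) \<odot> E i) = (\<Sum>i<n. ip X (E i) * L (E i))" if "n \<le> N" for n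
    using that
  proof (induction n)
    case (Suc n)
    have "(\<Sum>i<n. ip X (E i) \<odot> E i) \<in> V"
      using Suc.prems assms(2) by (intro V_sum) auto
    then show ?case using Suc assms unfolding tensorial_def by simp
  qed (simp add: zero)
  from this[of N] show ?thesis
    by (simp only: E_expand[OF assms(2), symmetric] order_refl)
qed

text \<open>Expanding \<open>w i\<close> in the frame and exchanging the two sums leaves the matrix
  of \<open>w\<close>, whose transpose is that of \<open>w'\<close>. Both families are given on the
  frame only, so they may also come from operators that are not tensorial.\<close>

lemma trace_swap:
  assumes "\<And>Y. Y \<in> V \<Longrightarrow> tensorial (\<lambda>X. B X Y)" "\<And>X. X \<in> V \<Longrightarrow> tensorial (B X)"
    and "\<And>i. i < N \<Longrightarrow> w i \<in> V" "\<And>i. i < N \<Longrightarrow> w' i \<in> V"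
    and "\<And>i j. i < N \<Longrightarrow> j < N \<Longrightarrow> ip (w i) (E j) = ip (w' j) (E i)"
  shows "(\<Sum>i<N. B (w i) (E i)) = (\<Sum>i<N. B (E i) (w' i))"
proof -
  have "(\<Sum>i<N. B (w i) (E i)) = (\<Sum>i<N. \<Sum>j<N. ip (w i) (E j) * B (E j) (E i))"
    using assms by (intro sum.cong refl tensorial_expand[of "\<lambda>X. B X _"]) auto
  also have "\<dots> = (\<Sum>j<N. \<Sum>i<N. ip (w i) (E j) * B (E j) (E i))"
    by (rule sum.swap)
  also have "\<dots> = (\<Sum>j<N. \<Sum>i<N. ip (w' j) (E i) * B (E j) (E i))"
    using assms(5) by simp
  also have "\<dots> = (\<Sum>j<N. B (E j) (w' j))"
    using assms by (intro sum.cong refl tensorial_expand[of "B _", symmetric]) auto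
  finally show ?thesis .
qed

lemma tensorial_uminus: "tensorial L \<Longrightarrow> X \<in> V \<Longrightarrow> L (- X) = - L X"
proof -
  assume L: "tensorial L" "X \<in> V"
  then have "L 0 = 0"
    unfolding tensorial_def by (metis V_zero add.right_neutral add_cancel_left_left)
  moreover have "L (X + - X) = L X + L (- X)"
    using L V_uminus unfolding tensorial_def by blast
  ultimately show ?thesis by (simp add: eq_neg_iff_add_eq_0 add.commute)
qed

text \<open>The case \<open>w' = - w\<close> of \<open>trace_swap\<close>; it serves both for \<phi>
  and for covariant derivatives of the frame.\<close>

lemma trace_skew:
  assumes "\<And>Y. Y \<in> V \<Longrightarrow> tensorial (\<lambda>X. B X Y)" "\<And>X. X \<in> V \<Longrightarrow> tensorial (B X)"
    and "\<And>i. i < N \<Longrightarrow> w i \<in> V"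
    and "\<And>i j. i < N \<Longrightarrow> j < N \<Longrightarrow> ip (w i) (E j) = - ip (E i) (w j)"
  shows "(\<Sum>i<N. B (w i) (E i)) = - (\<Sum>i<N. B (E i) (w i))"
proof -
  have "(\<Sum>i<N. B (w i) (E i)) = (\<Sum>i<N. B (E i) (- w i))"
  proof (rule trace_swap[OF assms(1,2,3)])
    show "ip (w i) (E j) = ip (- w j) (E i)" if "i < N" "j < N" for i j
      using assms(3)[OF that(2)] assms(4)[OF that] that
      by (simp only: ip_minus_left E_V ip_commute[of "w j" "E i"])
  qed (simp_all add: assms(3))
  also have "\<dots> = (\<Sum>i<N. - B (E i) (w i))"
    using assms(2,3) by (intro sum.cong refl tensorial_uminus[of "B _"]) auto
  finally show ?thesis by (simp add: sum_negf)
qed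

text \<open>The products \<open>ip (E i) (E j)\<close> have zero derivative, so the connection
  matrix of the frame is skew. This makes covariant differentiation commute with traces.\<close>

lemma trace_nb:
  assumes "\<And>Y. Y \<in> V \<Longrightarrow> tensorial (\<lambda>X. B X Y)" "\<And>X. X \<in> V \<Longrightarrow> tensorial (B X)"
    and "X \<in> V"
  shows "(\<Sum>i<N. B (nb X (E i)) (E i)) + (\<Sum>i<N. B (E i) (nb X (E i))) = 0"
proof -
  have "(\<Sum>i<N. B (nb X (E i)) (E i)) = - (\<Sum>i<N. B (E i) (nb X (E i)))"
  proof (rule trace_skew[OF assms(1,2)])
    show "ip (nb X (E i)) (E j) = - ip (E i) (nb X (E j))" if "i < N" "j < N" for i j
      using nb_metric[OF assms(3), of "E i" "E j"] d_ip_E[OF assms(3) that] that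
      by (simp add: eq_neg_iff_add_eq_0)
  qed (simp_all add: assms(3))
  then show ?thesis by simp
qed

lemma ip_expand_E:
  assumes "X \<in> V" "Y \<in> V"
  shows "ip X Y = (\<Sum>i<N. ip X (E i) * ip (E i) Y)"
  using tensorial_expand[of "\<lambda>X. ip X Y" X] assms by (simp add: tensorial_def ip_expand)

section \<open>Curvature and its symmetries\<close>

definition R :: "'v \<Rightarrow> 'v \<Rightarrow> 'v \<Rightarrow> 'v" where
  "R X Y Z = nb X (nb Y Z) - nb Y (nb X Z) - nb (nb X Y - nb Y X) Z"

lemma R_V [simp]: "X \<in> V \<Longrightarrow> Y \<in> V \<Longrightarrow> Z \<in> V \<Longrightarrow> R X Y Z \<in> V"
  by (simp add: R_def)

lemma R_swap: "X \<in> V \<Longrightarrow> Y \<in> V \<Longrightarrow> Z \<in> V \<Longrightarrow> R X Y Z = - R Y X Z"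
  by (simp add: R_def nb_expand)

lemma R_add2: "X \<in> V \<Longrightarrow> Y \<in> V \<Longrightarrow> Y' \<in> V \<Longrightarrow> Z \<in> V \<Longrightarrow> R X (Y + Y') Z = R X Y Z + R X Y' Z"
  by (simp add: R_def nb_expand algebra_simps)

lemma R_sm2: "f \<in> F \<Longrightarrow> X \<in> V \<Longrightarrow> Y \<in> V \<Longrightarrow> Z \<in> V \<Longrightarrow> R X (f \<odot> Y) Z = f \<odot> R X Y Z"
  by (simp add: R_def nb_expand sm_expand algebra_simps)

lemma R_add3: "X \<in> V \<Longrightarrow> Y \<in> V \<Longrightarrow> Z \<in> V \<Longrightarrow> Z' \<in> V \<Longrightarrow> R X Y (Z + Z') = R X Y Z + R X Y Z'"
  by (simp add: R_def nb_add_right algebra_simps)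

text \<open>The second derivatives of \<open>f\<close> cancel because \<open>nb X Y - nb Y X\<close>
  acts on functions as the commutator of \<open>X\<close> and \<open>Y\<close>.\<close>

lemma R_sm3:
  assumes "f \<in> F" "X \<in> V" "Y \<in> V" "Z \<in> V"
  shows "R X Y (f \<odot> Z) = f \<odot> R X Y Z"
  using assms
  by (simp add: R_def nb_sm_right nb_add_right d_bracket sm_expand algebra_simps)

text \<open>The bracket is written as \<open>nb X Y - nb Y X\<close>, so vanishing torsion is built
  in and the cyclic sum is a regrouping of the one in \<open>Jacobi\<close>.\<close>

lemma Bianchi:
  assumes "X \<in> V" "Y \<in> V" "Z \<in> V"
  shows "R X Y Z + R Y Z X + R Z X Y = 0"
  using Jacobi[OF assms] assms
  by (simp add: R_def Let_def nb_expand algebra_simps)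

text \<open>Expanding \<open>d_bracket\<close> for the function \<open>ip Z W\<close> by
  \<open>nb_metric\<close> shows that \<open>R X Y\<close> is skew.\<close>

lemma R_skew:
  assumes "X \<in> V" "Y \<in> V" "Z \<in> V" "W \<in> V"
  shows "ip (R X Y Z) W = - ip (R X Y W) Z"
proof -
  have "d (nb X Y - nb Y X) (ip Z W) = d X (d Y (ip Z W)) - d Y (d X (ip Z W))"
    using assms by (simp add: d_bracket)
  then have "ip (R X Y Z) W + ip Z (R X Y W) = 0"
    using assms by (simp add: R_def nb_metric d_add ip_expand algebra_simps)
  then show ?thesis
    using assms by (simp add: eq_neg_iff_add_eq_0 ip_commute)
qed

text \<open>The octahedron argument: Bianchi is used for each cyclic choice of three of the four
  arguments, and two of the resulting sums are subtracted from the other two. By the skew symmetries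
  only twice the difference of the two sides survives.\<close>

lemma R_pair:
  assumes "X \<in> V" "Y \<in> V" "Z \<in> V" "W \<in> V"
  shows "ip (R X Y Z) W = ip (R Z W X) Y"
proof -
  have B: "ip (R A B C) D + ip (R B C A) D + ip (R C A B) D = 0"
    if "A \<in> V" "B \<in> V" "C \<in> V" "D \<in> V" for A B C D
    using Bianchi[of A B C] that
    by (metis ip_add_left ip_zero_left R_V V_add)
  have s: "ip (R A B C) D = - ip (R B A C) D" if "A \<in> V" "B \<in> V" "C \<in> V" "D \<in> V" for A B C D
    using R_swap[of A B C] that by (simp add: ip_minus_left)
  have b1: "ip (R X Y Z) W + ip (R Y Z X) W + ip (R Z X Y) W = 0"
    using B assms by blast
  have b2: "- ip (R Y Z X) W - ip (R Z W X) Y + ip (R W Y Z) X = 0"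
    using B[of Y Z W X] R_skew[of Y Z W X] R_skew[of Z W Y X] assms by simp
  have b3: "ip (R Z W X) Y - ip (R W X Y) Z + ip (R Z X Y) W = 0"
    using B[of Z W X Y] R_skew[of W X Z Y] R_skew[of X Z W Y] s[of X Z Y W] assms by simp
  have b4: "ip (R W X Y) Z - ip (R X Y Z) W + ip (R W Y Z) X = 0"
    using B[of W X Y Z] R_skew[of X Y W Z] R_skew[of Y W X Z] s[of Y W Z X] assms by simp
  have "ip (R X Y Z) W + ip (R X Y Z) W - (ip (R Z W X) Y + ip (R Z W X) Y) =
      (ip (R X Y Z) W + ip (R Y Z X) W + ip (R Z X Y) W)
      + (- ip (R Y Z X) W - ip (R Z W X) Y + ip (R W Y Z) X)
      - (ip (R Z W X) Y - ip (R W X Y) Z + ip (R Z X Y) W)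
      - (ip (R W X Y) Z - ip (R X Y Z) W + ip (R W Y Z) X)"
    by (simp add: algebra_simps)
  then have "ip (R X Y Z) W + ip (R X Y Z) W = ip (R Z W X) Y + ip (R Z W X) Y"
    unfolding b1 b2 b3 b4 by simp
  then show ?thesis by (rule twice_cancel)
qed

text \<open>With this order of arguments \<open>Ric\<close> is the negative of the usual Ricci
  tensor of \<open>R\<close>.\<close>

definition Ric :: "'v \<Rightarrow> 'v \<Rightarrow> 'f" where
  "Ric X Y = (\<Sum>i<N. ip (R (E i) X (E i)) Y)"

lemma Ric_commute: "X \<in> V \<Longrightarrow> Y \<in> V \<Longrightarrow> Ric X Y = Ric Y X"
  unfolding Ric_def by (intro sum.cong refl R_pair) auto

end

section \<open>Contact metric structures\<close>

text \<open>The assumption \<open>contact\<close> is \<open>d\<eta> = \<Phi>\<close> with the factor \<open>1/2\<close> of \<open>d\<eta>\<close> cleared.\<close>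

locale framed_contact = framed_levi_civita V F sm ip nb d N E
  for V :: "'v::ab_group_add set"
    and F :: "'f::comm_ring_1 set"
    and sm :: "'f \<Rightarrow> 'v \<Rightarrow> 'v"  (infixr "\<odot>" 75)
    and ip :: "'v \<Rightarrow> 'v \<Rightarrow> 'f"
    and nb :: "'v \<Rightarrow> 'v \<Rightarrow> 'v"
    and d :: "'v \<Rightarrow> 'f \<Rightarrow> 'f"
    and N :: nat
    and E :: "nat \<Rightarrow> 'v" +
  fixes ph :: "'v \<Rightarrow> 'v" and xi :: 'v
  assumes V_ph [simp]: "X \<in> V \<Longrightarrow> ph X \<in> V"
    and ph_add: "X \<in> V \<Longrightarrow> Y \<in> V \<Longrightarrow> ph (X + Y) = ph X + ph Y"
    and ph_sm: "f \<in> F \<Longrightarrow> X \<in> V \<Longrightarrow> ph (f \<odot> X) = f \<odot> ph X"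
    and ph_ph: "X \<in> V \<Longrightarrow> ph (ph X) = - X + ip xi X \<odot> xi"
    and ph_skew: "X \<in> V \<Longrightarrow> Y \<in> V \<Longrightarrow> ip (ph X) Y = - ip X (ph Y)"
    and ph_xi [simp]: "ph xi = 0"
    and xi_V [simp]: "xi \<in> V"
    and d_ip_xi_xi: "X \<in> V \<Longrightarrow> d X (ip xi xi) = 0"
    and contact: "X \<in> V \<Longrightarrow> Y \<in> V \<Longrightarrow>
        ip (nb X xi) Y - ip (nb Y xi) X = ip X (ph Y) + ip X (ph Y)"
begin

section \<open>Algebra of \<phi> and \<xi>\<close>

lemma ph_zero [simp]: "ph 0 = 0"
  using ph_add[of 0 0] by simp

lemma ph_minus: "X \<in> V \<Longrightarrow> ph (- X) = - ph X"
  using ph_add[of X "- X"] by (simp add: eq_neg_iff_add_eq_0 add.commute)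

lemma ph_diff: "X \<in> V \<Longrightarrow> Y \<in> V \<Longrightarrow> ph (X - Y) = ph X - ph Y"
  using ph_add[of X "- Y"] by (simp add: ph_minus)

lemma ph_sum:
  fixes n :: nat
  assumes "\<And>i. i < n \<Longrightarrow> W i \<in> V"
  shows "ph (\<Sum>i<n. W i) = (\<Sum>i<n. ph (W i))"
  using assms by (induction n) (auto simp: ph_add)

lemmas ph_expand = ph_add ph_sm ph_minus ph_diff

lemma ip_xi_ph [simp]: "X \<in> V \<Longrightarrow> ip xi (ph X) = 0"
  using ph_skew[of xi X] by simp

text \<open>The substitute for \<open>ip xi xi = 1\<close>: for cut-off fields
  \<open>ip xi xi\<close> is the indicator function of the domain of the frame, which acts as the
  identity on \<open>xi\<close>.\<close>

lemma ip_xi_xi_sm: "ip xi xi \<odot> xi = xi"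
  using ph_ph[of xi] by simp

lemma ip_ph_ph: "X \<in> V \<Longrightarrow> Y \<in> V \<Longrightarrow> ip (ph X) (ph Y) = ip X Y - ip xi X * ip xi Y"
  by (simp add: ph_skew ph_ph ip_expand ip_commute[of X xi] algebra_simps)

section \<open>Covariant derivatives of \<xi> and \<phi>\<close>

definition A :: "'v \<Rightarrow> 'v" where "A X = nb X xi"

text \<open>The second covariant derivative of \<open>xi\<close> in the directions \<open>X\<close>,
  \<open>Y\<close>.\<close>

definition A2 :: "'v \<Rightarrow> 'v \<Rightarrow> 'v" where "A2 X Y = nb X (A Y) - A (nb X Y)"

text \<open>The covariant derivative of \<phi> along \<open>X\<close>, evaluated at
  \<open>Y\<close>.\<close>

definition P :: "'v \<Rightarrow> 'v \<Rightarrow> 'v" where "P X Y = nb X (ph Y) - ph (nb X Y)"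

text \<open>The second covariant derivative of \<phi> in the directions \<open>X\<close>,
  \<open>Y\<close>, evaluated at \<open>Z\<close>.\<close>

definition P2 :: "'v \<Rightarrow> 'v \<Rightarrow> 'v \<Rightarrow> 'v" where
  "P2 X Y Z = nb X (P Y Z) - P (nb X Y) Z - P Y (nb X Z)"

lemma A_V [simp]: "X \<in> V \<Longrightarrow> A X \<in> V"
  by (simp add: A_def)

lemma A2_V [simp]: "X \<in> V \<Longrightarrow> Y \<in> V \<Longrightarrow> A2 X Y \<in> V"
  by (simp add: A2_def)

lemma P_V [simp]: "X \<in> V \<Longrightarrow> Y \<in> V \<Longrightarrow> P X Y \<in> V"
  by (simp add: P_def)

lemma P2_V [simp]: "X \<in> V \<Longrightarrow> Y \<in> V \<Longrightarrow> Z \<in> V \<Longrightarrow> P2 X Y Z \<in> V"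
  by (simp add: P2_def)

lemma A_add: "X \<in> V \<Longrightarrow> Y \<in> V \<Longrightarrow> A (X + Y) = A X + A Y"
  by (simp add: A_def nb_add_left)

lemma A_sm: "f \<in> F \<Longrightarrow> X \<in> V \<Longrightarrow> A (f \<odot> X) = f \<odot> A X"
  by (simp add: A_def nb_sm_left)

lemma A_diff: "X \<in> V \<Longrightarrow> Y \<in> V \<Longrightarrow> A (X - Y) = A X - A Y"
  by (simp add: A_def nb_diff_left)

lemma P_add1: "X \<in> V \<Longrightarrow> X' \<in> V \<Longrightarrow> Y \<in> V \<Longrightarrow> P (X + X') Y = P X Y + P X' Y"
  by (simp add: P_def nb_add_left ph_add)

lemma P_add2: "X \<in> V \<Longrightarrow> Y \<in> V \<Longrightarrow> Y' \<in> V \<Longrightarrow> P X (Y + Y') = P X Y + P X Y'"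
  by (simp add: P_def nb_add_right ph_add)

lemma P_sm1: "f \<in> F \<Longrightarrow> X \<in> V \<Longrightarrow> Y \<in> V \<Longrightarrow> P (f \<odot> X) Y = f \<odot> P X Y"
  by (simp add: P_def nb_sm_left ph_sm sm_diff_right)

lemma P_sm2: "f \<in> F \<Longrightarrow> X \<in> V \<Longrightarrow> Y \<in> V \<Longrightarrow> P X (f \<odot> Y) = f \<odot> P X Y"
  by (simp add: P_def nb_sm_right ph_sm ph_add sm_diff_right)

lemmas tensor_expand = tensorial_def A_add A_sm P_add1 P_add2 P_sm1 P_sm2 R_add2 R_add3 R_sm2 R_sm3
  ph_add ph_sm ip_add_left ip_add_right ip_sm_left ip_sm_right

lemma A2_commute: "X \<in> V \<Longrightarrow> Y \<in> V \<Longrightarrow> A2 X Y = A2 Y X + R X Y xi"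
  by (simp add: A2_def A_def R_def nb_diff_left)

text \<open>The Ricci identity for an endomorphism: alternating its second derivative yields the
  commutator of the curvature with it.\<close>

lemma P2_commute:
  assumes "X \<in> V" "Y \<in> V" "Z \<in> V"
  shows "P2 X Y Z = P2 Y X Z + (R X Y (ph Z) - ph (R X Y Z))"
  using assms by (simp add: P2_def P_def R_def nb_expand ph_expand algebra_simps)

lemma P_xi: "X \<in> V \<Longrightarrow> P X xi = - ph (A X)"
  by (simp add: P_def A_def)

text \<open>The second covariant derivative of \<open>ph xi = 0\<close>, arranged by the product
  rule.\<close>

lemma P2_xi:
  assumes "X \<in> V" "Y \<in> V"
  shows "P2 X Y xi = - P X (A Y) - P Y (A X) - ph (A2 X Y)"
proof -
  have "nb X xi = A X" by (simp add: A_def)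
  then have "P2 X Y xi = - nb X (ph (A Y)) + ph (A (nb X Y)) - P Y (A X)"
    using assms by (simp add: P2_def P_xi nb_minus_right)
  moreover have "nb X (ph (A Y)) = P X (A Y) + ph (nb X (A Y))"
    by (simp add: P_def)
  ultimately show ?thesis
    using assms by (simp add: A2_def ph_diff)
qed

text \<open>Derivative of \<open>ph_skew\<close>: since the metric is parallel, the derivative of a
  skew endomorphism is skew.\<close>

lemma P_skew:
  assumes "X \<in> V" "Y \<in> V" "Z \<in> V"
  shows "ip X (P Z Y) = - ip (P Z X) Y"
proof -
  have "d Z (ip (ph X) Y) = - d Z (ip X (ph Y))"
    using assms by (simp add: ph_skew d_minus)
  then have "ip (nb Z (ph X)) Y + ip (ph X) (nb Z Y) =
      - (ip (nb Z X) (ph Y) + ip X (nb Z (ph Y)))"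
    using assms by (simp only: nb_metric V_ph)
  then show ?thesis
    using assms by (simp add: P_def ip_expand ph_skew[of X "nb Z Y"] ph_skew[of "nb Z X" Y] algebra_simps)
qed

lemma P2_skew:
  assumes "X \<in> V" "Y \<in> V" "Z \<in> V" "W \<in> V"
  shows "ip X (P2 W Z Y) = - ip (P2 W Z X) Y"
proof -
  have "d W (ip X (P Z Y)) = - d W (ip (P Z X) Y)"
    using assms by (simp add: P_skew d_minus)
  then have "ip (nb W X) (P Z Y) + ip X (nb W (P Z Y)) =
      - (ip (nb W (P Z X)) Y + ip (P Z X) (nb W Y))"
    using assms by (simp only: nb_metric P_V)
  then show ?thesis
    using assms P_skew[of "nb W X" Y Z] P_skew[of X "nb W Y" Z] P_skew[of X Y "nb W Z"]
    by (simp add: P2_def ip_expand algebra_simps)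
qed

lemma ip_A_xi [simp]: "X \<in> V \<Longrightarrow> ip (A X) xi = 0"
  using d_ip_xi_xi[of X] nb_metric[of X xi xi] twice_zero[of "ip (A X) xi"]
  by (simp add: A_def ip_commute[of xi "nb X xi"])

lemma ip_xi_A [simp]: "X \<in> V \<Longrightarrow> ip xi (A X) = 0"
  by (simp add: ip_commute[of xi "A X"])

lemma contact_A: "X \<in> V \<Longrightarrow> Y \<in> V \<Longrightarrow> ip (A X) Y = ip (A Y) X + (ip X (ph Y) + ip X (ph Y))"
  using contact[of X Y] by (simp add: A_def algebra_simps)

text \<open>In \<open>contact_A\<close> at \<open>xi\<close> the right-hand side vanishes, as \<xi>
  has constant length and \<phi> maps into ker \<eta>. Geometrically, the integral curves of \<xi>
  are geodesics.\<close>

lemma A_xi [simp]: "A xi = 0"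
proof (rule V_eqI)
  show "ip Z (A xi) = ip Z 0" if "Z \<in> V" for Z
    using contact_A[of xi Z] that by (simp add: ip_commute[of Z "A xi"])
qed auto

lemma ip_xi_nb: "X \<in> V \<Longrightarrow> Y \<in> V \<Longrightarrow> ip xi (nb X Y) = d X (ip xi Y) - ip (A X) Y"
  by (simp add: nb_metric A_def)

text \<open>Covariant derivative of \<open>ph_ph\<close>: the last two terms come from
  differentiating the two factors of \<eta> \<otimes> \<xi>.\<close>

lemma P_ph:
  assumes "X \<in> V" "Y \<in> V"
  shows "P X (ph Y) = - ph (P X Y) + ip (A X) Y \<odot> xi + ip xi Y \<odot> A X"
proof -
  have "P X (ph Y) + ph (P X Y) = nb X (ph (ph Y)) - ph (ph (nb X Y))"
    using assms by (simp add: P_def ph_diff)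
  also have "\<dots> = ip (A X) Y \<odot> xi + ip xi Y \<odot> A X"
    using assms
    by (simp add: ph_ph nb_expand ip_xi_nb sm_expand) (simp add: A_def)
  finally show ?thesis by (simp add: algebra_simps)
qed

text \<open>Covariant derivative of \<open>contact_A\<close> along \<open>Z\<close>; the terms in
  which an argument is differentiated cancel by \<open>contact_A\<close> itself.\<close>

lemma contact_derivative:
  assumes "X \<in> V" "Y \<in> V" "Z \<in> V"
  shows "ip (A2 Z X) Y = ip (A2 Z Y) X + (ip X (P Z Y) + ip X (P Z Y))"
proof -
  have "d Z (ip (A X) Y) = d Z (ip (A Y) X + (ip X (ph Y) + ip X (ph Y)))"
    using assms by (simp only: contact_A[of X Y])
  then have "ip (nb Z (A X)) Y + ip (A X) (nb Z Y) =
      ip (nb Z (A Y)) X + ip (A Y) (nb Z X)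
      + (ip (nb Z X) (ph Y) + ip X (nb Z (ph Y)) + (ip (nb Z X) (ph Y) + ip X (nb Z (ph Y))))"
    using assms by (simp only: d_add nb_metric F_ip F_add A_V V_ph)
  then show ?thesis
    using assms contact_A[of "nb Z X" Y] contact_A[of X "nb Z Y"]
    by (simp add: A2_def P_def ip_expand algebra_simps)
qed

text \<open>This is d\<Phi> = 0, a form of dd\<eta> = 0. Summing \<open>contact_derivative\<close>
  cyclically leaves the alternated second derivatives of \<xi>, which are curvature terms with zero
  cyclic sum by \<open>Bianchi\<close>; the result is twice the claim.\<close>

lemma Phi_closed:
  assumes "X \<in> V" "Y \<in> V" "Z \<in> V"
  shows "ip Y (P X Z) + ip Z (P Y X) + ip X (P Z Y) = 0"
proof -
  let ?s = "ip Y (P X Z) + ip Z (P Y X) + ip X (P Z Y)"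
  have sk: "ip (A2 X Y) Z = ip (A2 Y X) Z - ip (R X Y Z) xi" if "X \<in> V" "Y \<in> V" "Z \<in> V" for X Y Z
    using that by (simp add: A2_commute[of X Y] ip_add_left R_skew[of X Y xi Z])
  have "ip (R X Y Z + R Y Z X + R Z X Y) xi = 0"
    using assms by (simp add: Bianchi)
  then have "ip (R X Y Z) xi + ip (R Y Z X) xi + ip (R Z X Y) xi = 0"
    using assms by (simp add: ip_add_left)
  moreover have "?s + ?s + (ip (R X Y Z) xi + ip (R Y Z X) xi + ip (R Z X Y) xi) = 0"
    using contact_derivative[of Y Z X] contact_derivative[of Z X Y] contact_derivative[of X Y Z]
      sk[of X Y Z] sk[of Y Z X] sk[of Z X Y] assms
    by (simp add: algebra_simps)
  ultimately show ?thesis using twice_zero[of ?s] by simp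
qed

text \<open>Derivative of \<open>Phi_closed\<close> along \<open>W\<close>; the terms with
  differentiated arguments are closedness sums again and vanish.\<close>

lemma Phi_closed_derivative:
  assumes "X \<in> V" "Y \<in> V" "Z \<in> V" "W \<in> V"
  shows "ip Y (P2 W X Z) + ip Z (P2 W Y X) + ip X (P2 W Z Y) = 0"
proof -
  let ?cyc = "\<lambda>X Y Z. ip Y (P X Z) + ip Z (P Y X) + ip X (P Z Y)"
  have "ip Y (P2 W X Z) + ip Z (P2 W Y X) + ip X (P2 W Z Y) =
      d W (?cyc X Y Z) - ?cyc (nb W X) Y Z - ?cyc X (nb W Y) Z - ?cyc X Y (nb W Z)"
    using assms by (simp add: P2_def nb_metric d_add ip_expand)
  also have "\<dots> = 0"
    using assms by (simp add: Phi_closed)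
  finally show ?thesis .
qed

text \<open>By \<open>contact_A\<close> the sum of \<open>A\<close> and \<open>ph\<close> is a
  symmetric endomorphism, and \<open>A_ph\<close> says that it anticommutes with \<phi>.\<close>

lemma
  assumes "X \<in> V"
  shows P_xi_left: "P xi X = 0"
    and A_ph: "A (ph X) = - ph (A X) - (ph (ph X) + ph (ph X))"
proof -
  \<comment> \<open>\<open>B\<close> commutes with \<open>\<phi>\<close>, whereas \<open>P \<xi> = - B\<close> anticommutes with it.\<close>
  define B where "B = (\<lambda>X. A (ph X) + ph (A X) + (ph (ph X) + ph (ph X)))"
  have B_V: "B X \<in> V" if "X \<in> V" for X
    using that by (simp add: B_def)
  have PB: "P xi X = - B X" if "X \<in> V" for X
  proof (rule V_eqI)
    fix Y assume "Y \<in> V"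
    have "ip Y (P xi X) + ip X (P Y xi) + ip xi (P X Y) = 0"
      using that \<open>Y \<in> V\<close> by (simp add: Phi_closed)
    then have "ip Y (P xi X) + ip (ph X) (A Y) + ip Y (ph (A X)) = 0"
      using that \<open>Y \<in> V\<close>
      by (simp add: P_xi P_skew[of xi] ip_expand ph_skew[of X] ip_commute[of Y "ph (A X)"])
    moreover have "ip (ph X) (A Y) = ip Y (A (ph X)) + (ip Y (ph (ph X)) + ip Y (ph (ph X)))"
      using contact_A[of Y "ph X"] that \<open>Y \<in> V\<close>
      by (simp add: ip_commute[of Y] ip_commute[of "ph X" "A Y"])
    ultimately show "ip Y (P xi X) = ip Y (- B X)"
      using that \<open>Y \<in> V\<close> by (simp add: B_def ip_expand algebra_simps eq_neg_iff_add_eq_0)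
  qed (use that in \<open>auto simp: B_V\<close>)
  have "P xi (ph X) = - ph (P xi X)"
    using assms by (simp add: P_ph)
  then have "- B (ph X) = ph (B X)"
    using assms by (simp add: PB ph_minus B_V)
  then have anticommute: "B (ph X) = - ph (B X)"
    by (metis minus_minus)
  \<comment> \<open>\<open>A\<close> commutes with the square of \<phi>, because it kills \<xi> and
    takes values in ker \<eta>.\<close>
  have "B (ph X) = ph (B X)"
    using assms
    by (simp add: B_def ph_add A_diff A_sm ph_ph[of X] ph_ph[of "A X"] ph_diff ph_sm)
  then have "ph (B X) + ph (B X) = 0"
    using anticommute by (metis add.right_inverse)
  then have "ip Y (ph (B X)) = 0" if "Y \<in> V" for Y
    using that B_V[OF assms] ip_add_right[of "ph (B X)" "ph (B X)" Y] twice_zero by simp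
  then have "ph (B X) = 0"
    using B_V[OF assms] by (intro V_eqI) auto
  then have "B X = ip xi (B X) \<odot> xi"
    using ph_ph[OF B_V[OF assms]] by simp
  also have "ip xi (B X) = 0"
    using assms by (simp add: B_def ip_add_right)
  finally have "B X = 0" by simp
  then show "P xi X = 0" "A (ph X) = - ph (A X) - (ph (ph X) + ph (ph X))"
    using PB[OF assms] by (simp_all add: B_def algebra_simps eq_neg_iff_add_eq_0)
qed

section \<open>Traces of the derivatives and the divergence of \<phi>\<close>

lemma ip_ph_E: "i < N \<Longrightarrow> j < N \<Longrightarrow> ip (ph (E i)) (E j) = - ip (E i) (ph (E j))"
  by (simp add: ph_skew)

text \<open>Inside a trace over the frame \<phi> moves from one slot of a bilinear form to the other
  at the cost of a sign.\<close>

lemmas trace_ph = trace_skew[where w = "\<lambda>i. ph (E i)", OF _ _ V_ph[OF E_V] ip_ph_E]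

lemma trace_ph_zero: "(\<Sum>i<N. ip (ph (E i)) (E i)) = 0"
proof -
  have "(\<Sum>i<N. ip (ph (E i)) (E i)) = - (\<Sum>i<N. ip (E i) (ph (E i)))"
    by (rule trace_ph) (simp_all add: tensor_expand)
  then have "(\<Sum>i<N. ip (ph (E i)) (E i)) + (\<Sum>i<N. ip (E i) (ph (E i))) = 0"
    by (simp add: eq_neg_iff_add_eq_0)
  then show ?thesis
    by (simp add: ip_commute[of _ "ph _"] twice_zero)
qed

text \<open>\<xi> is divergence free: the trace of \<open>ip (A (ph X)) (ph X)\<close> is minus the
  trace of \<open>A\<close> by \<open>A_ph\<close>, but plus the trace of \<open>A\<close> when one
  \<phi> is moved to the other slot.\<close>

lemma trace_A: "(\<Sum>i<N. ip (A (E i)) (E i)) = 0"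
proof -
  let ?t = "\<Sum>i<N. ip (A (E i)) (E i)"
  have "ip (A (ph (E i))) (ph (E i)) =
      - ip (A (E i)) (E i) - (ip (ph (E i)) (E i) + ip (ph (E i)) (E i))" if "i < N" for i
    using that by (simp add: A_ph ip_diff_left ip_minus_left ip_add_left ip_ph_ph)
  then have "(\<Sum>i<N. ip (A (ph (E i))) (ph (E i))) = - ?t"
    by (simp add: sum_subtractf sum_negf sum_distrib_left[symmetric] trace_ph_zero)
  moreover have "(\<Sum>i<N. ip (A (ph (E i))) (ph (E i))) = - (\<Sum>i<N. ip (A (E i)) (ph (ph (E i))))"
    by (rule trace_ph) (simp_all add: tensor_expand)
  moreover have "ip (A (E i)) (ph (ph (E i))) = - ip (A (E i)) (E i)" if "i < N" for i
    using that by (simp add: ph_ph ip_diff_right ip_sm_right)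
  ultimately have "- ?t = ?t" by (simp add: sum_negf)
  then show ?thesis
    using twice_zero[of ?t] by (simp add: minus_equation_iff eq_neg_iff_add_eq_0)
qed

text \<open>\<open>c\<close> is the constant \<open>2n\<close>; only its constancy matters.\<close>

definition c :: 'f where "c = (\<Sum>i<N. ip (ph (A (E i))) (E i))"

lemma c_F [simp]: "c \<in> F"
  by (simp add: c_def)

text \<open>The right-hand side is built from functions with zero derivative, as \<open>d_c\<close>
  requires. It appears on tracing \<open>A_ph\<close>, where moving \<phi> turns the left-hand side
  into \<open>c\<close> while the first term on the right is \<open>- c\<close>.\<close>

lemma c_eq: "c = (\<Sum>i<N. ip (E i) (E i)) - ip xi xi"
proof -
  have "(\<Sum>i<N. ip (A (ph (E i))) (E i)) = - (\<Sum>i<N. ip (A (E i)) (ph (E i)))"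
    by (rule trace_ph) (simp_all add: tensor_expand)
  also have "\<dots> = c"
    by (simp add: c_def ph_skew sum_negf)
  finally have 1: "(\<Sum>i<N. ip (A (ph (E i))) (E i)) = c" .
  have 2: "ip (A (ph (E i))) (E i) = - ip (ph (A (E i))) (E i) +
      (ip (E i) (E i) - ip xi (E i) * ip (E i) xi) + (ip (E i) (E i) - ip xi (E i) * ip (E i) xi)"
    if "i < N" for i
    using that
    by (simp add: A_ph ph_ph ip_diff_left ip_add_left ip_minus_left ip_sm_left ip_commute[of xi "E i"])
  have "(\<Sum>i<N. ip xi (E i) * ip (E i) xi) = ip xi xi"
    by (simp add: ip_expand_E[of xi xi])
  then have "c = - c + ((\<Sum>i<N. ip (E i) (E i)) - ip xi xi) + ((\<Sum>i<N. ip (E i) (E i)) - ip xi xi)"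
    using 1 2 by (simp add: sum.distrib sum_subtractf sum_negf sum_distrib_left[symmetric] c_def algebra_simps)
  then have "c + c = ((\<Sum>i<N. ip (E i) (E i)) - ip xi xi) + ((\<Sum>i<N. ip (E i) (E i)) - ip xi xi)"
    by (metis (no_types, lifting) add.assoc add.commute add.left_inverse add_0_right)
  then show ?thesis by (rule twice_cancel)
qed

lemma d_c: "X \<in> V \<Longrightarrow> d X c = 0"
  unfolding c_eq by (simp add: d_diff d_sum d_ip_E d_ip_xi_xi)

text \<open>Up to a factor 2 the left-hand side is the derivative of the trace of the square of
  \<phi>, which is constant. Here \<open>P_ph\<close> evaluates each summand, and the results add up
  to \<open>ip (A X) xi\<close>.\<close>

lemma trace_P: "X \<in> V \<Longrightarrow> (\<Sum>i<N. ip (E i) (P X (ph (E i)))) = 0"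
proof -
  assume X: "X \<in> V"
  have "ip (E i) (P X (ph (E i))) = ip (A X) (E i) * ip (E i) xi" if "i < N" for i
  proof (rule twice_cancel)
    have "ip (E i) (ph (P X (E i))) = ip (P X (ph (E i))) (E i)"
      using X that P_skew[of "ph (E i)" "E i" X] ph_skew[of "E i" "P X (E i)"] by simp
    then have "ip (E i) (P X (ph (E i))) =
        - ip (E i) (P X (ph (E i))) + ip (A X) (E i) * ip (E i) xi + ip xi (E i) * ip (E i) (A X)"
      using X that ip_commute[of "P X (ph (E i))" "E i"]
      by (simp add: P_ph[of X "E i"] ip_diff_right ip_add_right ip_minus_right ip_sm_right)
    then show "ip (E i) (P X (ph (E i))) + ip (E i) (P X (ph (E i))) =
        ip (A X) (E i) * ip (E i) xi + ip (A X) (E i) * ip (E i) xi"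
      using X that by (simp add: ip_commute[of xi "E i"] ip_commute[of "A X" "E i"] algebra_simps)
  qed
  then show ?thesis
    using X ip_expand_E[of "A X" xi] by simp
qed

text \<open>\<open>Phi_closed\<close> on \<open>X\<close>, \<open>E i\<close>,
  \<open>ph (E i)\<close> gives three traces: one vanishes by \<open>trace_P\<close>, and the other
  two differ by moving \<phi>, which makes the sum equal to its negative.\<close>

lemma trace_P_ph:
  assumes "X \<in> V"
  shows "(\<Sum>i<N. ip X (P (E i) (ph (E i)))) = 0" (is "?U = 0")
proof -
  have eq: "ip (E i) (P X (ph (E i))) + ip X (P (ph (E i)) (E i)) = ip X (P (E i) (ph (E i)))"
    if "i < N" for i
    using assms that Phi_closed[of X "E i" "ph (E i)"] P_skew[of "ph (E i)" X "E i"]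
      ip_commute[of X "P (E i) (ph (E i))"]
    by (simp add: algebra_simps)
  have "(\<Sum>i<N. ip X (P (ph (E i)) (E i))) = - ?U"
    using assms by (intro trace_ph) (simp_all add: tensor_expand)
  then have "?U = - ?U"
    using assms by (simp add: eq[symmetric] sum.distrib trace_P)
  then show ?thesis
    using twice_zero[of ?U] by (simp only: eq_neg_iff_add_eq_0)
qed

text \<open>By \<open>P_ph\<close> the image of the divergence under \<phi> reduces to
  \<open>trace_P_ph\<close>, \<open>trace_A\<close> and \<open>A xi\<close>, all zero. Only a
  \<xi>-component remains, and \<open>P_xi\<close> identifies it with \<open>c\<close>.\<close>

lemma divergence_ph: "(\<Sum>i<N. P (E i) (E i)) = c \<odot> xi" (is "?D = _")
proof -
  have "ip Z (ph ?D) = ip Z 0" if Z: "Z \<in> V" for Z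
  proof -
    have eq: "ip Z (ph (P (E i) (E i))) = - ip Z (P (E i) (ph (E i)))
        + ip (A (E i)) (E i) * ip Z xi + ip xi (E i) * ip Z (A (E i))" if "i < N" for i
      using Z that by (simp add: P_ph[of "E i" "E i"] ip_add_right ip_diff_right ip_minus_right ip_sm_right)
    have "(\<Sum>i<N. ip xi (E i) * ip Z (A (E i))) = ip Z (A xi)"
      using Z by (intro tensorial_expand[symmetric]) (simp_all add: tensor_expand del: A_xi)
    then show ?thesis
      using Z by (simp add: ph_sum ip_sum_right eq sum.distrib sum_subtractf trace_P_ph trace_A
          sum_distrib_right[symmetric])
  qed
  then have "ph ?D = 0" by (intro V_eqI) auto
  then have "?D = ip xi ?D \<odot> xi"
    using ph_ph[of ?D] by simp
  also have "ip xi ?D = c"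
    by (simp add: ip_sum_right c_def P_skew P_xi ip_minus_left)
  finally show ?thesis .
qed

text \<open>Derivative of \<open>divergence_ph\<close> along \<open>X\<close>: by
  \<open>trace_nb\<close> it commutes with the trace, and \<open>c\<close> is constant.\<close>

lemma trace_P2:
  assumes "X \<in> V" "Y \<in> V"
  shows "(\<Sum>i<N. ip Y (P2 X (E i) (E i))) = c * ip Y (A X)"
proof -
  have "(\<Sum>i<N. ip Y (P (nb X (E i)) (E i))) + (\<Sum>i<N. ip Y (P (E i) (nb X (E i)))) = 0"
    using assms by (intro trace_nb) (simp_all add: tensor_expand)
  moreover have "(\<Sum>i<N. ip Y (P2 X (E i) (E i))) = (\<Sum>i<N. ip Y (nb X (P (E i) (E i))))
      - (\<Sum>i<N. ip Y (P (nb X (E i)) (E i))) - (\<Sum>i<N. ip Y (P (E i) (nb X (E i))))"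
    using assms by (simp add: P2_def ip_diff_right sum_subtractf)
  ultimately have "(\<Sum>i<N. ip Y (P2 X (E i) (E i))) = ip Y (nb X (\<Sum>i<N. P (E i) (E i)))"
    using assms by (simp add: nb_sum_right ip_sum_right diff_diff_eq)
  also have "\<dots> = c * ip Y (A X)"
    using assms by (simp add: divergence_ph nb_sm_right d_c ip_sm_right A_def)
  finally show ?thesis .
qed

lemma trace_A2:
  assumes "X \<in> V"
  shows "(\<Sum>i<N. ip (A2 X (E i)) (E i)) = 0"
proof -
  have "(\<Sum>i<N. ip (A (nb X (E i))) (E i)) + (\<Sum>i<N. ip (A (E i)) (nb X (E i))) = 0"
    using assms by (intro trace_nb) (simp_all add: tensor_expand)
  then have "(\<Sum>i<N. ip (A2 X (E i)) (E i)) = (\<Sum>i<N. d X (ip (A (E i)) (E i)))"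
    using assms by (simp add: A2_def nb_metric ip_diff_left sum_subtractf sum.distrib algebra_simps)
  also have "\<dots> = d X (\<Sum>i<N. ip (A (E i)) (E i))"
    using assms by (simp add: d_sum)
  finally show ?thesis using assms by (simp add: trace_A)
qed

section \<open>The curvature trace \<open>S\<close> and the Laplacians of \<xi> and \<phi>\<close>

definition S :: "'v \<Rightarrow> 'v \<Rightarrow> 'f" where
  "S X Y = (\<Sum>i<N. ip (R X (E i) (ph (E i))) Y)"

lemma S_add_left: "X \<in> V \<Longrightarrow> X' \<in> V \<Longrightarrow> Y \<in> V \<Longrightarrow> S (X + X') Y = S X Y + S X' Y"
proof -
  assume V: "X \<in> V" "X' \<in> V" "Y \<in> V"
  have "R (X + X') Z W = R X Z W + R X' Z W" if "Z \<in> V" "W \<in> V" for Z W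
    using R_swap[of _ Z W] that V by (simp add: R_add2)
  then show ?thesis
    using V by (simp add: S_def ip_add_left sum.distrib)
qed

lemma S_sm_left: "f \<in> F \<Longrightarrow> X \<in> V \<Longrightarrow> Y \<in> V \<Longrightarrow> S (f \<odot> X) Y = f * S X Y"
proof -
  assume V: "f \<in> F" "X \<in> V" "Y \<in> V"
  have "R (f \<odot> X) Z W = f \<odot> R X Z W" if "Z \<in> V" "W \<in> V" for Z W
    using R_swap[of _ Z W] that V by (simp add: R_sm2 sm_minus_right)
  then show ?thesis
    using V by (simp add: S_def ip_sm_left sum_distrib_left)
qed

text \<open>\<open>Bianchi\<close> and moving \<phi> express twice \<open>S X Y\<close> as minus the
  trace of \<open>ip (R (E i) (ph (E i)) X) Y\<close>, which is skew in \<open>X\<close> and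
  \<open>Y\<close>.\<close>

lemma S_skew:
  assumes "X \<in> V" "Y \<in> V"
  shows "S X Y = - S Y X"
proof -
  have half: "S X Y + S X Y = - (\<Sum>i<N. ip (R (E i) (ph (E i)) X) Y)" if "X \<in> V" "Y \<in> V" for X Y
  proof -
    have "(\<Sum>i<N. ip (R X (ph (E i)) (E i)) Y) = - (\<Sum>i<N. ip (R X (E i) (ph (E i))) Y)"
      using that by (intro trace_ph) (simp_all add: tensor_expand)
    moreover have "ip (R (E i) (ph (E i)) X) Y = - ip (R X (E i) (ph (E i))) Y + ip (R X (ph (E i)) (E i)) Y"
      if "i < N" for i
    proof -
      have "R (E i) (ph (E i)) X = - R X (E i) (ph (E i)) + R X (ph (E i)) (E i)"
        using Bianchi[of X "E i" "ph (E i)"] R_swap[of "ph (E i)" X "E i"] that \<open>X \<in> V\<close>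
        by (simp add: algebra_simps)
      then show ?thesis
        using that \<open>X \<in> V\<close> \<open>Y \<in> V\<close> by (simp add: ip_diff_left ip_add_left ip_minus_left)
    qed
    ultimately show ?thesis
      by (simp add: S_def sum.distrib sum_negf sum_subtractf)
  qed
  have "(\<Sum>i<N. ip (R (E i) (ph (E i)) X) Y) = - (\<Sum>i<N. ip (R (E i) (ph (E i)) Y) X)"
    using assms by (simp add: R_skew[of _ _ X Y] sum_negf)
  then have "S X Y + S X Y = (- S Y X) + (- S Y X)"
    using half[OF assms] half[OF assms(2,1)] by (metis minus_add_distrib minus_minus)
  then show ?thesis by (rule twice_cancel)
qed

text \<open>In the trace of \<open>contact_derivative\<close> exchanging the arguments costs a
  divergence of \<phi>, commuting the derivatives costs a Ricci term, and what remains is the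
  derivative of the trace of \<open>A\<close>, which is zero.\<close>

lemma ip_Laplacian_xi:
  assumes "Y \<in> V"
  shows "ip (\<Sum>i<N. A2 (E i) (E i)) Y = - (c * ip xi Y + c * ip xi Y) - Ric Y xi"
proof -
  have eq: "ip (A2 (E i) (E i)) Y = ip (A2 Y (E i)) (E i) - ip (R (E i) Y (E i)) xi
      - (ip (P (E i) (E i)) Y + ip (P (E i) (E i)) Y)" if "i < N" for i
    using that assms contact_derivative[of "E i" Y "E i"]
    by (simp add: A2_commute[of "E i" Y] ip_add_left R_skew[of "E i" Y xi "E i"]
        P_skew[of "E i" Y "E i"])
  have "(\<Sum>i<N. ip (P (E i) (E i)) Y) = c * ip xi Y"
    using assms by (simp add: ip_sum_left[symmetric] divergence_ph ip_sm_left)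
  then show ?thesis
    using assms by (simp add: ip_sum_left eq sum_subtractf sum.distrib trace_A2 Ric_def
        sum_distrib_left[symmetric])
qed

lemma Ric_zero_right [simp]: "X \<in> V \<Longrightarrow> Ric X 0 = 0"
  by (simp add: Ric_def)

lemma Ric_minus_right: "X \<in> V \<Longrightarrow> Y \<in> V \<Longrightarrow> Ric X (- Y) = - Ric X Y"
  by (simp add: Ric_def ip_minus_right sum_negf)

text \<open>The Ricci identity brings the two \<open>E i\<close> together, where
  \<open>trace_P2\<close> applies. Of the two curvature terms one is \<open>S\<close>, the other a
  Ricci term.\<close>

lemma trace_P2_middle:
  assumes "X \<in> V" "Y \<in> V"
  shows "(\<Sum>i<N. ip Y (P2 (E i) X (E i))) = c * ip (A X) Y - S X Y + Ric X (ph Y)"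
proof -
  have eq: "ip Y (P2 (E i) X (E i)) =
      ip Y (P2 X (E i) (E i)) - ip (R X (E i) (ph (E i))) Y + ip (R (E i) X (E i)) (ph Y)"
    if "i < N" for i
    using that assms
    by (simp add: P2_commute[of "E i" X] ip_add_right ip_diff_right ip_minus_right R_swap[of "E i" X "ph (E i)"]
        ip_commute[of Y "R _ _ _"] ip_commute[of Y "ph (R _ _ _)"] ph_skew[of "R (E i) X (E i)" Y])
  show ?thesis
    using assms by (simp add: eq sum.distrib sum_subtractf trace_P2 S_def Ric_def ip_commute[of Y "A X"])
qed

text \<open>The Weitzenboeck formula: \<open>Phi_closed_derivative\<close> along \<open>E i\<close>,
  with \<open>E i\<close> also as an argument, trades the Laplacian for two traces covered by
  \<open>trace_P2_middle\<close>. \<open>S_skew\<close> adds up the \<open>S\<close> terms, and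
  \<open>contact_A\<close> turns the difference of the \<open>c\<close> terms into a multiple of
  \<Phi>.\<close>

lemma ip_Laplacian_ph:
  assumes "X \<in> V" "Y \<in> V"
  shows "ip X (\<Sum>i<N. P2 (E i) (E i) Y) = - (c * ip X (ph Y) + c * ip X (ph Y))
    + (S X Y + S X Y) - Ric X (ph Y) + Ric Y (ph X)"
proof -
  have "ip X (P2 (E i) (E i) Y) = ip X (P2 (E i) Y (E i)) - ip Y (P2 (E i) X (E i))" if "i < N" for i
    using that assms Phi_closed_derivative[of "E i" X Y "E i"] P2_skew[of "E i" X Y "E i"]
    by (simp add: ip_commute[of X "P2 _ _ _"] algebra_simps)
  then have "ip X (\<Sum>i<N. P2 (E i) (E i) Y) =
      (\<Sum>i<N. ip X (P2 (E i) Y (E i))) - (\<Sum>i<N. ip Y (P2 (E i) X (E i)))"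
    using assms by (simp add: ip_sum_right sum_subtractf)
  also have "\<dots> = c * ip (A Y) X - S Y X + Ric Y (ph X) - (c * ip (A X) Y - S X Y + Ric X (ph Y))"
    using assms by (simp only: trace_P2_middle)
  finally show ?thesis
    using S_skew[OF assms(2,1)] contact_A[OF assms] by (simp add: algebra_simps)
qed

section \<open>The induced connection on the contact distribution\<close>

definition pr :: "'v \<Rightarrow> 'v" where "pr X = X - ip xi X \<odot> xi"

definition nbar :: "'v \<Rightarrow> 'v \<Rightarrow> 'v" where "nbar X Y = pr (nb X Y)"

text \<open>\<open>L\<close> is an arbitrary map of fields, so that the construction can be applied
  again to \<open>nbar_End Y ph\<close>.\<close>

definition nbar_End :: "'v \<Rightarrow> ('v \<Rightarrow> 'v) \<Rightarrow> 'v \<Rightarrow> 'v" where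
  "nbar_End X L Y = nbar X (L Y) - L (nbar X Y)"

definition nbar2_ph :: "'v \<Rightarrow> 'v \<Rightarrow> 'v \<Rightarrow> 'v" where
  "nbar2_ph X Y Z = nbar_End X (nbar_End Y ph) Z - nbar_End (nb X Y) ph Z"

definition lap_ph :: "'v \<Rightarrow> 'v" where
  "lap_ph Y = - (\<Sum>i<N. nbar2_ph (E i) (E i) Y)"

definition T :: 'v where
  "T = (\<Sum>i<N. nbar_End (E i) ph (A (E i)))"

lemma pr_V [simp]: "X \<in> V \<Longrightarrow> pr X \<in> V"
  by (simp add: pr_def)

lemma nbar_V [simp]: "X \<in> V \<Longrightarrow> Y \<in> V \<Longrightarrow> nbar X Y \<in> V"
  by (simp add: nbar_def)

lemma pr_add: "X \<in> V \<Longrightarrow> Y \<in> V \<Longrightarrow> pr (X + Y) = pr X + pr Y"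
  by (simp add: pr_def ip_add_right sm_add_left)

lemma pr_diff: "X \<in> V \<Longrightarrow> Y \<in> V \<Longrightarrow> pr (X - Y) = pr X - pr Y"
  by (simp add: pr_def ip_diff_right sm_diff_left)

lemma pr_sm: "f \<in> F \<Longrightarrow> X \<in> V \<Longrightarrow> pr (f \<odot> X) = f \<odot> pr X"
  by (simp add: pr_def ip_sm_right sm_diff_right sm_sm)

lemma pr_zero [simp]: "pr 0 = 0"
  by (simp add: pr_def)

lemma pr_sum:
  fixes n :: nat
  assumes "\<And>i. i < n \<Longrightarrow> W i \<in> V"
  shows "pr (\<Sum>i<n. W i) = (\<Sum>i<n. pr (W i))"
  using assms by (induction n) (auto simp: pr_add)

lemma pr_D: "ip xi X = 0 \<Longrightarrow> pr X = X"
  by (simp add: pr_def)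

lemma pr_xi [simp]: "pr xi = 0"
  by (simp add: pr_def ip_xi_xi_sm)

lemma ph_pr [simp]: "X \<in> V \<Longrightarrow> ph (pr X) = ph X"
  by (simp add: pr_def ph_diff ph_sm)

lemma pr_eq: "X \<in> V \<Longrightarrow> pr X = - ph (ph X)"
  by (simp add: pr_def ph_ph)

lemma ip_pr: "X \<in> V \<Longrightarrow> Y \<in> V \<Longrightarrow> ip X (pr Y) = ip (pr X) Y"
  by (simp add: pr_eq ip_minus_left ip_minus_right ph_skew)

lemma nbar_End_ph: "X \<in> V \<Longrightarrow> Y \<in> V \<Longrightarrow> nbar_End X ph Y = pr (P X Y)"
  by (simp add: nbar_End_def nbar_def P_def pr_diff pr_D[of "ph _"])

text \<open>The corrections quadratic in \<open>A\<close> come from the \<xi>-components removed by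
  the projections: that of \<open>nb X Y\<close> is \<open>- ip (A X) Y\<close>, that of
  \<open>P Z Y\<close> is \<open>ip (ph (A Z)) Y\<close>.\<close>

lemma nbar2_ph_eq:
  assumes "X \<in> V" "Z \<in> V" "Y \<in> V" "ip xi Y = 0"
  shows "nbar2_ph X Z Y = pr (P2 X Z Y) - ip (ph (A Z)) Y \<odot> A X + ip (A X) Y \<odot> ph (A Z)"
proof -
  have xi: "ip xi (nb X Y) = - ip (A X) Y" "ip xi (P Z Y) = ip (ph (A Z)) Y"
    using assms by (simp_all add: ip_xi_nb P_skew P_xi ip_minus_left)
  have "nbar X (pr (P Z Y)) = pr (nb X (P Z Y)) - ip (ph (A Z)) Y \<odot> A X"
    using assms
    by (simp add: nbar_def pr_def[of "P Z Y"] xi nb_diff_right nb_sm_right pr_diff pr_add pr_sm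
        A_def[symmetric] pr_D[of "A X"])
  moreover have "pr (P Z (nbar X Y)) = pr (P Z (nb X Y)) - ip (A X) Y \<odot> ph (A Z)"
    using assms
    by (simp add: nbar_def pr_def[of "nb X Y"] xi sm_minus_left P_add2 P_sm2 P_xi pr_add pr_sm
        pr_D[of "ph (A Z)"] ip_minus_right sm_minus_right pr_diff)
  ultimately show ?thesis
    using assms
    by (simp add: nbar2_ph_def nbar_End_def[of X "nbar_End Z ph"] nbar_End_ph P2_def pr_diff pr_add
        algebra_simps)
qed

text \<open>When both directions are \<open>E i\<close>, the quadratic corrections of
  \<open>nbar2_ph_eq\<close> commute with \<phi> and drop out.\<close>

lemma lap_ph_commutator:
  assumes "Y \<in> V" "ip xi Y = 0"
  shows "lap_ph (ph Y) - ph (lap_ph Y) =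
    ph (\<Sum>i<N. P2 (E i) (E i) Y) - pr (\<Sum>i<N. P2 (E i) (E i) (ph Y))"
proof -
  have 1: "ip (ph (A X)) (ph Y) = ip (A X) Y" "ip (A X) (ph Y) = - ip (ph (A X)) Y"
    if "X \<in> V" for X
    using that assms by (simp add: ip_ph_ph) (use that assms in \<open>simp add: ph_skew\<close>)
  have "nbar2_ph (E i) (E i) (ph Y) - ph (nbar2_ph (E i) (E i) Y) =
      pr (P2 (E i) (E i) (ph Y)) - ph (P2 (E i) (E i) Y)" if "i < N" for i
    using that assms
    by (simp add: nbar2_ph_eq 1 ph_diff ph_add ph_sm ph_ph[of "A _"] sm_minus_left sm_minus_right)
  then have "(\<Sum>i<N. nbar2_ph (E i) (E i) (ph Y) - ph (nbar2_ph (E i) (E i) Y)) =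
      (\<Sum>i<N. pr (P2 (E i) (E i) (ph Y)) - ph (P2 (E i) (E i) Y))"
    by (intro sum.cong) auto
  moreover have "nbar2_ph (E i) (E i) Y \<in> V" if "i < N" for i
    using that assms by (simp add: nbar2_ph_eq)
  ultimately show ?thesis
    using assms by (simp add: lap_ph_def ph_sum pr_sum ph_minus sum_subtractf algebra_simps)
qed

text \<open>After insertion of \<open>ip_Laplacian_ph\<close> the \<open>c\<close> terms cancel, and
  so do the Ricci terms by symmetry of \<open>Ric\<close>. What is left is twice the antisymmetrised
  *-Ricci tensor, with \<open>X\<close> projected in one of the two terms.\<close>

lemma ip_lap_ph_commutator:
  assumes "X \<in> V" "Y \<in> V" "ip xi Y = 0"
  shows "ip X (lap_ph (ph Y) - ph (lap_ph Y)) =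
    (S Y (ph X) - S (pr X) (ph Y)) + (S Y (ph X) - S (pr X) (ph Y))"
proof -
  let ?L = "\<lambda>Y. \<Sum>i<N. P2 (E i) (E i) Y"
  have Y: "pr Y = Y" "ph (ph Y) = - Y" and X: "ph (ph X) = - pr X"
    using assms by (simp_all add: pr_D ph_ph pr_def)
  have ip: "ip (ph X) (ph Y) = ip X Y" "ip (pr X) Y = ip X Y"
    using assms ip_pr[of X Y] by (simp_all add: ip_ph_ph Y)
  have "ip X (lap_ph (ph Y) - ph (lap_ph Y)) = - ip (ph X) (?L Y) - ip (pr X) (?L (ph Y))"
    using assms by (simp add: lap_ph_commutator ip_diff_right ip_pr ph_skew)
  also have "\<dots> = - (S (ph X) Y + S (ph X) Y) - (S (pr X) (ph Y) + S (pr X) (ph Y))"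
    using assms Ric_commute[of "pr X" Y] Ric_commute[of "ph X" "ph Y"]
    by (simp only: ip_Laplacian_ph V_ph pr_V X Y ip ip_minus_right Ric_minus_right ph_pr)
      (simp add: algebra_simps)
  finally show ?thesis
    using assms S_skew[of "ph X" Y] by (simp add: algebra_simps)
qed

text \<open>The Laplacian of \<phi> at \<xi> is computed twice. By \<open>P2_xi\<close> and
  \<open>tau\<close> it is minus twice a sum whose image under \<phi> is \<open>ph T\<close>; by the
  Weitzenboeck formula it is a multiple of \<open>S\<close>, the Ricci term vanishing by
  \<open>ip_Laplacian_xi\<close> and \<open>tau\<close>.\<close>

lemma ip_ph_T:
  assumes tau: "(\<Sum>i<N. A2 (E i) (E i)) = h \<odot> xi" and "h \<in> F" "Z \<in> V"
  shows "ip Z (ph T) = - S xi (ph Z)"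
proof -
  let ?W = "\<Sum>i<N. P (E i) (A (E i))"
  have "(\<Sum>i<N. ph (A2 (E i) (E i))) = ph (h \<odot> xi)"
    by (simp add: tau[symmetric] ph_sum)
  then have "(\<Sum>i<N. ph (A2 (E i) (E i))) = 0"
    using assms by (simp add: ph_sm)
  then have L: "(\<Sum>i<N. P2 (E i) (E i) xi) = - ?W - ?W"
    by (simp add: P2_xi sum_subtractf sum_negf)
  have Ric: "Ric xi (ph X) = 0" if "X \<in> V" for X
    using ip_Laplacian_xi[of "ph X"] tau assms that Ric_commute[of xi "ph X"]
    by (simp add: ip_sm_left)
  have "ip (ph Z) (- ?W - ?W) = S (ph Z) xi + S (ph Z) xi"
    using assms by (simp add: L[symmetric] ip_Laplacian_ph Ric)
  then have "- ip (ph Z) ?W + - ip (ph Z) ?W = S (ph Z) xi + S (ph Z) xi"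
    using assms by (simp add: ip_diff_right ip_minus_right)
  then have "- ip (ph Z) ?W = - S xi (ph Z)"
    using assms S_skew[of "ph Z" xi] twice_cancel by simp
  moreover have "ph T = ph ?W"
    by (simp add: T_def nbar_End_ph ph_sum)
  ultimately show ?thesis
    using assms ph_skew[of Z ?W] by simp
qed

lemma lap_ph_V [simp]: "Y \<in> V \<Longrightarrow> lap_ph Y \<in> V"
  by (simp add: lap_ph_def nbar2_ph_def nbar_End_def)

lemma T_V [simp]: "T \<in> V"
  by (simp add: T_def nbar_End_def)

text \<open>The hypothesis \<open>tau\<close> encodes harmonicity of \<xi>: the Laplacian of \<xi>
  is pointwise proportional to \<xi>, whatever the factor \<open>h\<close>.\<close>

theorem harmonic_iff_symmetric:
  assumes tau: "(\<Sum>i<N. A2 (E i) (E i)) = h \<odot> xi" and h: "h \<in> F"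
  shows "ph T = 0 \<and> (\<forall>Y\<in>V. ip xi Y = 0 \<longrightarrow> lap_ph (ph Y) - ph (lap_ph Y) = 0) \<longleftrightarrow>
    (\<forall>X\<in>V. \<forall>Y\<in>V. S X (ph Y) = S Y (ph X))"
proof (intro iffI ballI conjI impI)
  fix X Y
  assume *: "ph T = 0 \<and> (\<forall>Y\<in>V. ip xi Y = 0 \<longrightarrow> lap_ph (ph Y) - ph (lap_ph Y) = 0)"
    and V: "X \<in> V" "Y \<in> V"
  have S_xi: "S xi (ph Z) = 0" if "Z \<in> V" for Z
    using ip_ph_T[OF tau h that] * that by simp
  \<comment> \<open>Since \<open>S xi (ph W)\<close> vanishes, the \<xi>-component of the first
    argument does not contribute.\<close>
  have S_pr: "S (pr Z) (ph W) = S Z (ph W)" if "Z \<in> V" "W \<in> V" for Z W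
  proof -
    have "S (pr Z + ip xi Z \<odot> xi) (ph W) = S (pr Z) (ph W) + ip xi Z * S xi (ph W)"
      using that by (simp add: S_add_left S_sm_left)
    moreover have "pr Z + ip xi Z \<odot> xi = Z" by (simp add: pr_def)
    ultimately show ?thesis using that by (simp add: S_xi)
  qed
  \<comment> \<open>The commutator condition speaks about sections of D only, so it is used at
    \<open>pr Y\<close>, which \<phi> does not distinguish from \<open>Y\<close>.\<close>
  have "ip xi (pr Y) = 0"
    using V by (simp add: pr_eq ip_minus_right)
  moreover have "pr Y \<in> V" using V by simp
  ultimately have "ip X (lap_ph (ph (pr Y)) - ph (lap_ph (pr Y))) = ip X 0"
    using * by metis
  then have "S (pr Y) (ph X) - S (pr X) (ph (pr Y)) = 0"
    unfolding ip_lap_ph_commutator[OF V(1) \<open>pr Y \<in> V\<close> \<open>ip xi (pr Y) = 0\<close>] ip_zero_right[OF V(1)]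
    by (rule twice_zero)
  then show "S X (ph Y) = S Y (ph X)"
    using V by (simp add: S_pr)
next
  assume sym: "\<forall>X\<in>V. \<forall>Y\<in>V. S X (ph Y) = S Y (ph X)"
  \<comment> \<open>Symmetry for the pair \<open>xi\<close>, \<open>Z\<close>: the other side
    contains \<open>ph xi\<close>.\<close>
  have "S xi (ph Z) = 0" if "Z \<in> V" for Z
    using sym that by (simp add: S_def)
  then show "ph T = 0"
    using ip_ph_T[OF tau h] by (intro V_eqI) auto
  fix Y assume Y: "Y \<in> V" "ip xi Y = 0"
  have "S (pr X) (ph Y) = S Y (ph X)" if "X \<in> V" for X
    using sym Y that by simp
  then show "lap_ph (ph Y) - ph (lap_ph Y) = 0"
    using Y by (intro V_eqI) (simp_all only: ip_lap_ph_commutator, simp_all)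
qed

end

section \<open>Restriction to the domain of a frame\<close>

locale contact_frame = almost_contact_metric_structure M charts g nabla phi xi eta
  for M :: "'a topology" and charts :: "('a set \<times> ('a \<Rightarrow> 'e::euclidean_space)) set"
    and g and nabla ("\<nabla>") and phi ("\<phi>") and xi ("\<xi>") and eta ("\<eta>") +
  fixes U :: "'a set" and E :: "nat \<Rightarrow> 'a vfield"
  assumes frame: "orthonormal_frame_on U E"
    and contact_metric: contact_metric
begin

text \<open>Cutting fields and functions off to \<open>0\<close> outside \<open>U\<close> turns equality on \<open>U\<close> into equality.\<close>

definition restr :: "'a vfield \<Rightarrow> 'a vfield" where
  "restr X = (\<lambda>p. if p \<in> U then X p else 0)"

definition fields :: "'a vfield set" where
  "fields = {X. vector_field_on U X \<and> (\<forall>p. p \<notin> U \<longrightarrow> X p = 0)}"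

definition ip :: "'a vfield \<Rightarrow> 'a vfield \<Rightarrow> 'a \<Rightarrow> real" where
  "ip X Y = (\<lambda>p. if p \<in> U then g p (X p) (Y p) else 0)"

definition nb :: "'a vfield \<Rightarrow> 'a vfield \<Rightarrow> 'a vfield" where
  "nb X Y = restr (\<nabla> X Y)"

definition dir_deriv :: "'a vfield \<Rightarrow> ('a \<Rightarrow> real) \<Rightarrow> 'a \<Rightarrow> real" where
  "dir_deriv X f = (\<lambda>p. X p f)"

section \<open>Metric and frame at a point\<close>

lemma U_openin: "openin M U"
  using frame by (simp add: orthonormal_frame_on_def)

lemma U_topspace: "p \<in> U \<Longrightarrow> p \<in> topspace M"
  using openin_subset[OF U_openin] by auto

lemma restr_in [simp]: "p \<in> U \<Longrightarrow> restr X p = X p"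
  and restr_out [simp]: "p \<notin> U \<Longrightarrow> restr X p = 0"
  by (simp_all add: restr_def)

lemma restr_eq_iff: "restr X = restr Y \<longleftrightarrow> (\<forall>p\<in>U. X p = Y p)"
  by (auto simp: restr_def fun_eq_iff)

lemma field_vector_field: "X \<in> fields \<Longrightarrow> vector_field_on U X"
  and field_out: "X \<in> fields \<Longrightarrow> p \<notin> U \<Longrightarrow> X p = 0"
  by (simp_all add: fields_def)

lemma field_tangent: "X \<in> fields \<Longrightarrow> p \<in> U \<Longrightarrow> X p \<in> tangent_space p"
  using field_vector_field vector_field_on_tangent by blast

lemma vector_field_restr: "vector_field_on U X \<Longrightarrow> vector_field_on U (restr X)"
  by (erule vector_field_on_cong) simp

lemma restr_fields [simp]: "vector_field_on U X \<Longrightarrow> restr X \<in> fields"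
  by (simp add: fields_def vector_field_restr)

lemma restr_field: "X \<in> fields \<Longrightarrow> restr X = X"
  by (rule ext) (simp add: restr_def fields_def)

lemma field_eqI: "X \<in> fields \<Longrightarrow> Y \<in> fields \<Longrightarrow> (\<And>p. p \<in> U \<Longrightarrow> X p = Y p) \<Longrightarrow> X = Y"
  by (metis restr_eq_iff restr_field)

lemma E_vector_field: "i < DIM('e) \<Longrightarrow> vector_field_on U (E i)"
  and E_orthonormal: "p \<in> U \<Longrightarrow> i < DIM('e) \<Longrightarrow> j < DIM('e) \<Longrightarrow>
    g p (E i p) (E j p) = (if i = j then 1 else 0)"
  and E_span: "p \<in> U \<Longrightarrow> span ((\<lambda>i. E i p) ` {..<DIM('e)}) = tangent_space p"
  using frame by (auto simp: orthonormal_frame_on_def)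

lemma xi_vector_field: "vector_field_on U \<xi>"
  using vector_field_on_subset[OF xi_field U_openin] openin_subset[OF U_openin] .

lemma g_add_left: "p \<in> U \<Longrightarrow> u \<in> tangent_space p \<Longrightarrow> v \<in> tangent_space p \<Longrightarrow> w \<in> tangent_space p \<Longrightarrow>
    g p (u + v) w = g p u w + g p v w"
  and g_scaleR_left: "p \<in> U \<Longrightarrow> u \<in> tangent_space p \<Longrightarrow> w \<in> tangent_space p \<Longrightarrow>
    g p (a *\<^sub>R u) w = a * g p u w"
  and g_commute: "p \<in> U \<Longrightarrow> u \<in> tangent_space p \<Longrightarrow> w \<in> tangent_space p \<Longrightarrow> g p u w = g p w u"
  using metric U_topspace unfolding riemannian_metric_def by blast+

lemma g_smooth: "vector_field_on U X \<Longrightarrow> vector_field_on U Y \<Longrightarrow>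
    smooth_fun_on U (\<lambda>p. g p (X p) (Y p))"
  using metric by (simp add: riemannian_metric_def)

lemma g_zero_left: "p \<in> U \<Longrightarrow> w \<in> tangent_space p \<Longrightarrow> g p 0 w = 0"
  using g_scaleR_left[of p 0 w 0] by (simp add: tangent_space_zero)

lemma g_uminus_left: "p \<in> U \<Longrightarrow> u \<in> tangent_space p \<Longrightarrow> w \<in> tangent_space p \<Longrightarrow>
    g p (- u) w = - g p u w"
  using g_scaleR_left[of p u w "- 1"] by simp

lemma g_diff_left: "p \<in> U \<Longrightarrow> u \<in> tangent_space p \<Longrightarrow> v \<in> tangent_space p \<Longrightarrow>
    w \<in> tangent_space p \<Longrightarrow> g p (u - v) w = g p u w - g p v w"
  using g_add_left[of p u "- v" w] by (simp add: g_uminus_left tangent_space_uminus)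

lemma g_definite:
  assumes "p \<in> U" "u \<in> tangent_space p" "g p u u = 0"
  shows "u = 0"
proof -
  have "u \<noteq> 0 \<longrightarrow> g p u u > 0"
    using metric U_topspace[OF assms(1)] assms(2) unfolding riemannian_metric_def by blast
  then show ?thesis using assms(3) by auto
qed

text \<open>Induction over the span of the frame: the right-hand side is linear in \<open>v\<close>
  and reproduces each frame vector by orthonormality. Tangency is carried along because
  \<open>g\<close> is linear on tangent vectors only.\<close>

lemma frame_expansion:
  assumes "p \<in> U" "v \<in> tangent_space p"
  shows "v = (\<Sum>i<DIM('e). g p v (E i p) *\<^sub>R E i p)"
proof -
  have E: "E i p \<in> tangent_space p" if "i < DIM('e)" for i
    using that assms(1) E_vector_field vector_field_on_tangent by blast
  have "v \<in> span ((\<lambda>i. E i p) ` {..<DIM('e)})"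
    using assms by (simp add: E_span)
  then have "v \<in> tangent_space p \<and> (\<Sum>i<DIM('e). g p v (E i p) *\<^sub>R E i p) = v"
  proof (induction rule: span_induct_alt)
    case base
    have "g p 0 (E i p) = 0" if "i < DIM('e)" for i
      using that E assms(1) by (intro g_zero_left)
    then show ?case using tangent_space_zero[of p] by (simp add: zero_fun_def)
  next
    case (step a x y)
    then obtain j where j: "j < DIM('e)" "x = E j p" by auto
    have "(\<Sum>i<DIM('e). g p x (E i p) *\<^sub>R E i p) = (\<Sum>i<DIM('e). (if i = j then E i p else 0))"
      using j assms(1) by (intro sum.cong) (auto simp: E_orthonormal)
    also have "\<dots> = x"
      using j by simp
    finally have x: "(\<Sum>i<DIM('e). g p x (E i p) *\<^sub>R E i p) = x" .
    have T: "x \<in> tangent_space p" "y \<in> tangent_space p" using j E step by auto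
    have "(\<Sum>i<DIM('e). g p (a *\<^sub>R x + y) (E i p) *\<^sub>R E i p) =
        (\<Sum>i<DIM('e). a *\<^sub>R g p x (E i p) *\<^sub>R E i p + g p y (E i p) *\<^sub>R E i p)"
      using T E assms(1)
      by (intro sum.cong) (auto simp: g_add_left g_scaleR_left tangent_space_scaleR scaleR_add_left)
    also have "\<dots> = a *\<^sub>R x + y"
      using x step scaleR_sum_right[of a "\<lambda>i. g p x (E i p) *\<^sub>R E i p" "{..<DIM('e)}"]
      by (simp add: sum.distrib)
    finally have "(\<Sum>i<DIM('e). g p (a *\<^sub>R x + y) (E i p) *\<^sub>R E i p) = a *\<^sub>R x + y" .
    moreover have "a *\<^sub>R x + y \<in> tangent_space p"
      using T by (simp add: tangent_space_add tangent_space_scaleR)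
    ultimately show ?case by (simp add: plus_fun_def)
  qed
  then show ?thesis by simp
qed

section \<open>The Levi-Civita connection over the domain\<close>

lemma nabla_affine:
  assumes "vector_field_on U X" "vector_field_on U Y" "vector_field_on U Z" "smooth_fun_on U f"
  shows "vector_field_on U (\<nabla> X Y)"
    and "p \<in> U \<Longrightarrow> \<nabla> (X + Y) Z p = \<nabla> X Z p + \<nabla> Y Z p"
    and "p \<in> U \<Longrightarrow> \<nabla> (f \<cdot> X) Y p = f p *\<^sub>R \<nabla> X Y p"
    and "p \<in> U \<Longrightarrow> \<nabla> X (Y + Z) p = \<nabla> X Y p + \<nabla> X Z p"
    and "p \<in> U \<Longrightarrow> \<nabla> X (f \<cdot> Y) p = X p f *\<^sub>R Y p + f p *\<^sub>R \<nabla> X Y p"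
  using levi_civita assms unfolding levi_civita_connection_def affine_connection_def by blast+

lemma nabla_torsion_metric:
  assumes "vector_field_on U X" "vector_field_on U Y" "vector_field_on U Z" "p \<in> U"
  shows "\<nabla> X Y p - \<nabla> Y X p = lie_bracket X Y p"
    and "X p (\<lambda>q. g q (Y q) (Z q)) = g p (\<nabla> X Y p) (Z p) + g p (Y p) (\<nabla> X Z p)"
  using levi_civita assms by (simp_all add: levi_civita_connection_def)

lemma vector_field_nabla: "vector_field_on U X \<Longrightarrow> vector_field_on U Y \<Longrightarrow> vector_field_on U (\<nabla> X Y)"
  using nabla_affine(1) smooth_fun_on_const[OF U_openin] by blast

text \<open>Locality: multiplication by the indicator function \<open>e\<close> of \<open>U\<close>
  makes the fields equal as total functions. Inside \<open>\<nabla>\<close> the factor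
  \<open>e\<close> has no effect at points of \<open>U\<close>, where its value is 1 and its
  derivative 0.\<close>

lemma nabla_cong:
  assumes X: "vector_field_on U X" "vector_field_on U X'" "\<And>q. q \<in> U \<Longrightarrow> X q = X' q"
    and Y: "vector_field_on U Y" "vector_field_on U Y'" "\<And>q. q \<in> U \<Longrightarrow> Y q = Y' q"
    and p: "p \<in> U"
  shows "\<nabla> X Y p = \<nabla> X' Y' p"
proof -
  define e :: "'a \<Rightarrow> real" where "e = (\<lambda>q. if q \<in> U then 1 else 0)"
  have e: "smooth_fun_on U e"
    using smooth_fun_on_cong[OF smooth_fun_on_const[OF U_openin], of 1 e] by (simp add: e_def)
  have "e \<cdot> X = e \<cdot> X'" "e \<cdot> Y = e \<cdot> Y'"
    using X(3) Y(3) by (auto simp: fscale_def e_def fun_eq_iff)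
  moreover have "\<nabla> (e \<cdot> Z) Y p = \<nabla> Z Y p" if "vector_field_on U Z" for Z
    using nabla_affine(3)[OF that Y(1) Y(1) e p] p by (simp add: e_def)
  moreover have "X' p e = 0"
    using tangent_local[OF vector_field_on_tangent[OF X(2) p] e p, of "\<lambda>_. 1"]
      tangent_const[OF vector_field_on_tangent[OF X(2) p] U_topspace[OF p]] by (simp add: e_def)
  moreover have "\<nabla> X' (e \<cdot> Z) p = X' p e *\<^sub>R Z p + \<nabla> X' Z p" if "vector_field_on U Z" for Z
    using nabla_affine(5)[OF X(2) that that e p] p by (simp add: e_def)
  ultimately show ?thesis using X Y by (metis scale_zero_left add_0_left)
qed

lemma restr_nabla: "vector_field_on U X \<Longrightarrow> vector_field_on U Y \<Longrightarrow> restr (\<nabla> X Y) = nb (restr X) (restr Y)"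
  unfolding nb_def restr_eq_iff by (intro ballI nabla_cong) (auto simp: vector_field_restr)

section \<open>The tensor \<phi> at a point\<close>

lemma J_vector_field: "vector_field_on U X \<Longrightarrow> vector_field_on U (J X)"
  using phi_tensor unfolding tensor11_def J_def by blast

lemma phi_tangent: "p \<in> U \<Longrightarrow> u \<in> tangent_space p \<Longrightarrow> \<phi> p u \<in> tangent_space p"
  and phi_add: "p \<in> U \<Longrightarrow> u \<in> tangent_space p \<Longrightarrow> v \<in> tangent_space p \<Longrightarrow>
    \<phi> p (u + v) = \<phi> p u + \<phi> p v"
  and phi_scaleR: "p \<in> U \<Longrightarrow> u \<in> tangent_space p \<Longrightarrow> \<phi> p (a *\<^sub>R u) = a *\<^sub>R \<phi> p u"
  using phi_tensor U_topspace unfolding tensor11_def by blast+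

lemma phi_uminus: "p \<in> U \<Longrightarrow> u \<in> tangent_space p \<Longrightarrow> \<phi> p (- u) = - \<phi> p u"
  using phi_scaleR[of p u "- 1"] by simp

lemma xi_tangent: "p \<in> U \<Longrightarrow> \<xi> p \<in> tangent_space p"
  using xi_vector_field vector_field_on_tangent by blast

text \<open>By \<open>phi_compat\<close> the squared length of \<open>\<phi> p (\<xi> p)\<close> is
  1 - 1.\<close>

lemma phi_xi: assumes "p \<in> U" shows "\<phi> p (\<xi> p) = 0"
proof (rule g_definite[OF assms])
  show "g p (\<phi> p (\<xi> p)) (\<phi> p (\<xi> p)) = 0"
    using assms by (simp add: phi_compat U_topspace xi_tangent eta_dual xi_unit)
qed (use assms in \<open>simp add: phi_tangent xi_tangent\<close>)

text \<open>The cube of \<phi> is computed in two ways, with \<open>phi_phi\<close> applied inside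
  and outside; the results differ by the \<xi>-component of \<open>\<phi> p u\<close>.\<close>

lemma eta_phi:
  assumes "p \<in> U" "u \<in> tangent_space p"
  shows "\<eta> p (\<phi> p u) = 0"
proof -
  note T = assms(2) phi_tangent[OF assms] xi_tangent[OF assms(1)]
  have "\<phi> p (\<phi> p (\<phi> p u)) = \<phi> p (- u + \<eta> p u *\<^sub>R \<xi> p)"
    using assms by (simp add: phi_phi U_topspace)
  also have "\<dots> = \<phi> p (- u) + \<phi> p (\<eta> p u *\<^sub>R \<xi> p)"
    using T assms(1) by (intro phi_add) (auto intro: tangent_space_uminus tangent_space_scaleR)
  also have "\<dots> = - \<phi> p u"
    using T assms(1) by (simp add: phi_uminus phi_scaleR phi_xi)
  finally have "\<phi> p (\<phi> p (\<phi> p u)) = - \<phi> p u" .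
  moreover have "\<phi> p (\<phi> p (\<phi> p u)) = - \<phi> p u + \<eta> p (\<phi> p u) *\<^sub>R \<xi> p"
    using T assms(1) by (intro phi_phi U_topspace)
  ultimately have "\<eta> p (\<phi> p u) *\<^sub>R \<xi> p = 0"
    by simp
  moreover have "\<xi> p \<noteq> 0"
    using xi_unit[OF U_topspace[OF assms(1)]] g_zero_left[OF assms(1) T(3)] by auto
  ultimately show ?thesis by simp
qed

text \<open>\<open>phi_compat\<close> for \<open>\<phi> p v\<close> and \<open>u\<close>, where the
  \<eta> term vanishes by \<open>eta_phi\<close>, compared with the expansion of the square of
  \<phi>.\<close>

lemma phi_skew:
  assumes "p \<in> U" "u \<in> tangent_space p" "v \<in> tangent_space p"
  shows "g p (\<phi> p u) v = - g p u (\<phi> p v)"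
proof -
  note T = assms(2,3) phi_tangent[OF assms(1,2)] phi_tangent[OF assms(1,3)]
    xi_tangent[OF assms(1)]
  have "g p u (\<phi> p v) = g p (\<phi> p (\<phi> p v)) (\<phi> p u)"
    using T assms(1) by (simp add: phi_compat U_topspace eta_phi phi_tangent g_commute)
  also have "\<dots> = g p (- v + \<eta> p v *\<^sub>R \<xi> p) (\<phi> p u)"
    using T assms(1) by (simp add: phi_phi U_topspace)
  also have "\<dots> = g p (- v) (\<phi> p u) + g p (\<eta> p v *\<^sub>R \<xi> p) (\<phi> p u)"
    using T assms(1) by (intro g_add_left) (auto intro: tangent_space_uminus tangent_space_scaleR)
  also have "\<dots> = - g p v (\<phi> p u) + \<eta> p v * \<eta> p (\<phi> p u)"
    using T assms(1) by (simp add: g_uminus_left g_scaleR_left eta_dual U_topspace)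
  finally show ?thesis
    using T assms(1) by (simp add: eta_phi g_commute)
qed

section \<open>Cut-off fields as a model of the abstract setting\<close>

definition ph :: "'a vfield \<Rightarrow> 'a vfield" where
  "ph X = restr (J X)"

lemma fields_add: "X \<in> fields \<Longrightarrow> Y \<in> fields \<Longrightarrow> X + Y \<in> fields"
  by (simp add: fields_def vector_field_on_add)

lemma fields_uminus: "X \<in> fields \<Longrightarrow> - X \<in> fields"
  by (simp add: fields_def vector_field_on_uminus)

lemma fields_fscale: "smooth_fun_on U f \<Longrightarrow> X \<in> fields \<Longrightarrow> f \<cdot> X \<in> fields"
  by (simp add: fields_def vector_field_on_fscale) (simp add: fscale_def)

lemma fields_zero: "0 \<in> fields"
  by (simp add: fields_def vector_field_on_zero U_openin)

lemma fields_nb: "X \<in> fields \<Longrightarrow> Y \<in> fields \<Longrightarrow> nb X Y \<in> fields"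
  by (simp add: nb_def vector_field_nabla field_vector_field)

lemma fields_ph: "X \<in> fields \<Longrightarrow> ph X \<in> fields"
  by (simp add: ph_def J_vector_field field_vector_field)

lemma nb_in: "p \<in> U \<Longrightarrow> nb X Y p = \<nabla> X Y p"
  and nb_out: "p \<notin> U \<Longrightarrow> nb X Y p = 0"
  by (simp_all add: nb_def)

lemma ph_in: "p \<in> U \<Longrightarrow> ph X p = \<phi> p (X p)"
  and ph_out: "p \<notin> U \<Longrightarrow> ph X p = 0"
  by (simp_all add: ph_def J_def)

lemma ip_in: "p \<in> U \<Longrightarrow> ip X Y p = g p (X p) (Y p)"
  and ip_out: "p \<notin> U \<Longrightarrow> ip X Y p = 0"
  by (simp_all add: ip_def)

lemma ip_smooth: "X \<in> fields \<Longrightarrow> Y \<in> fields \<Longrightarrow> smooth_fun_on U (ip X Y)"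
  by (rule smooth_fun_on_cong[OF g_smooth]) (auto simp: ip_in field_vector_field)

lemma dir_deriv_smooth: "X \<in> fields \<Longrightarrow> smooth_fun_on U f \<Longrightarrow> smooth_fun_on U (dir_deriv X f)"
  unfolding dir_deriv_def using vector_field_on_smooth[OF field_vector_field] by blast

lemma dir_deriv_out: "X \<in> fields \<Longrightarrow> p \<notin> U \<Longrightarrow> dir_deriv X f p = 0"
  by (simp add: dir_deriv_def field_out)

lemma dir_deriv_local:
  assumes "X \<in> fields" "smooth_fun_on U f" "\<And>q. q \<in> U \<Longrightarrow> f q = h q"
  shows "dir_deriv X f = dir_deriv X h"
proof
  fix p show "dir_deriv X f p = dir_deriv X h p"
    using tangent_local[OF field_tangent[OF assms(1)] assms(2) _ assms(3), of p] dir_deriv_out[OF assms(1)]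
    by (cases "p \<in> U") (auto simp: dir_deriv_def)
qed

lemma dir_deriv_const:
  assumes "X \<in> fields" "\<And>q. q \<in> U \<Longrightarrow> f q = a"
  shows "dir_deriv X f = 0"
proof -
  have "dir_deriv X f = dir_deriv X (\<lambda>_. a)"
    using assms dir_deriv_local[OF assms(1) smooth_fun_on_const[OF U_openin], of a f] by simp
  also have "\<dots> = 0"
  proof
    fix p show "dir_deriv X (\<lambda>_. a) p = 0 p"
      using tangent_const[OF field_tangent[OF assms(1)] U_topspace, of p a] dir_deriv_out[OF assms(1)]
      by (cases "p \<in> U") (auto simp: dir_deriv_def)
  qed
  finally show ?thesis .
qed

lemma bracket_in:
  "X \<in> fields \<Longrightarrow> Y \<in> fields \<Longrightarrow> p \<in> U \<Longrightarrow> (nb X Y - nb Y X) p = lie_bracket X Y p"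
  using nabla_torsion_metric(1)[of X Y X p] by (simp add: nb_in field_vector_field)

lemma bracket_dir_deriv:
  assumes "X \<in> fields" "Y \<in> fields" "smooth_fun_on U f"
  shows "dir_deriv (nb X Y - nb Y X) f = dir_deriv X (dir_deriv Y f) - dir_deriv Y (dir_deriv X f)"
proof
  fix p show "dir_deriv (nb X Y - nb Y X) f p = (dir_deriv X (dir_deriv Y f) - dir_deriv Y (dir_deriv X f)) p"
  proof (cases "p \<in> U")
    case True
    then show ?thesis
      using fun_cong[OF bracket_in[OF assms(1,2) True], of f] smooth_fun_near[OF assms(3) True]
      by (simp add: dir_deriv_def lie_bracket_def)
  next
    case False
    then show ?thesis
      using assms by (simp add: dir_deriv_def nb_out field_out)
  qed
qed

lemma fields_bracket: "X \<in> fields \<Longrightarrow> Y \<in> fields \<Longrightarrow> nb X Y - nb Y X \<in> fields"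
  using fields_add[OF fields_nb fields_uminus[OF fields_nb], of X Y Y X] by simp

lemma Jacobi_fields:
  assumes "X \<in> fields" "Y \<in> fields" "Z \<in> fields"
  shows "let br = (\<lambda>X Y. nb X Y - nb Y X) in
    br X (br Y Z) + br Y (br Z X) + br Z (br X Y) = 0"
proof -
  define br where "br = (\<lambda>X Y. nb X Y - nb Y X)"
  have br: "br A B \<in> fields" "p \<in> U \<Longrightarrow> br A B p = lie_bracket A B p"
    if "A \<in> fields" "B \<in> fields" for A B p
    using fields_bracket[OF that] bracket_in[OF that] by (auto simp: br_def)
  have "br X (br Y Z) + br Y (br Z X) + br Z (br X Y) = 0"
  proof (rule field_eqI)
    show "(br X (br Y Z) + br Y (br Z X) + br Z (br X Y)) p = 0 p" if p: "p \<in> U" for p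
      using lie_bracket_cyclic[OF assms[THEN field_vector_field] p br(2) br(2) br(2)] assms p br
      by simp
  qed (use assms br(1) in \<open>auto intro!: fields_add fields_zero\<close>)
  then show ?thesis by (simp add: br_def Let_def)
qed

text \<open>Metric compatibility and vanishing torsion turn 2 d\<eta>(X,Y) into the left-hand side:
  the products of \<xi> with the derivatives of \<open>X\<close> and \<open>Y\<close> cancel against
  the bracket term.\<close>

lemma contact_ip:
  assumes "X \<in> fields" "Y \<in> fields"
  shows "ip (nb X (restr \<xi>)) Y - ip (nb Y (restr \<xi>)) X = ip X (ph Y) + ip X (ph Y)"
proof
  fix p
  show "(ip (nb X (restr \<xi>)) Y - ip (nb Y (restr \<xi>)) X) p = (ip X (ph Y) + ip X (ph Y)) p"
  proof (cases "p \<in> U")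
    case p: True
    note v = assms[THEN field_vector_field] xi_vector_field
    have xi: "nb Z (restr \<xi>) p = \<nabla> Z \<xi> p" if "Z \<in> fields" for Z
      using restr_nabla[OF field_vector_field[OF that] xi_vector_field] p restr_field[OF that]
      by (metis restr_in)
    have eta: "A p (\<lambda>q. \<eta> q (B q)) = g p (\<nabla> A \<xi> p) (B p) + g p (\<xi> p) (\<nabla> A B p)"
      if "A \<in> fields" "B \<in> fields" for A B
    proof -
      \<comment> \<open>\<open>eta_dual\<close> identifies the two functions on \<open>U\<close>
        only, which is enough since derivations are local.\<close>
      have "A p (\<lambda>q. g q (\<xi> q) (B q)) = A p (\<lambda>q. \<eta> q (B q))"
      proof (rule tangent_local[OF field_tangent[OF that(1) p]
            g_smooth[OF xi_vector_field field_vector_field[OF that(2)]] p])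
        show "g q (\<xi> q) (B q) = \<eta> q (B q)" if "q \<in> U" for q
          by (rule eta_dual[symmetric]) (fact U_topspace[OF that], fact field_tangent[OF \<open>B \<in> fields\<close> that])
      qed
      then show ?thesis
        using nabla_torsion_metric(2)[OF field_vector_field[OF that(1)] xi_vector_field
            field_vector_field[OF that(2)] p] by simp
    qed
    have T: "\<nabla> X Y p \<in> tangent_space p" "\<nabla> Y X p \<in> tangent_space p"
      using vector_field_nabla v p vector_field_on_tangent by blast+
    then have "\<nabla> X Y p - \<nabla> Y X p \<in> tangent_space p"
      by (rule subspace_diff[OF subspace_tangent_space])
    then have "\<eta> p (lie_bracket X Y p) = g p (\<nabla> X Y p - \<nabla> Y X p) (\<xi> p)"
      using nabla_torsion_metric(1)[OF v(1,2,2) p] p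
      by (metis eta_dual U_topspace g_commute xi_tangent)
    also have "\<dots> = g p (\<xi> p) (\<nabla> X Y p) - g p (\<xi> p) (\<nabla> Y X p)"
      using T p by (simp add: g_diff_left xi_tangent g_commute[of p "\<xi> p"])
    finally have "deta X Y p = 1/2 * (g p (\<nabla> X \<xi> p) (Y p) - g p (\<nabla> Y \<xi> p) (X p))"
      using eta[OF assms] eta[OF assms(2,1)] by (simp add: deta_def)
    moreover have "deta X Y p = g p (X p) (\<phi> p (Y p))"
      using contact_metric v p unfolding contact_metric_def fundamental_form_def by blast
    ultimately show ?thesis
      using p assms by (simp add: ip_in xi ph_in)
  qed (simp add: ip_out)
qed

lemma ip_xi_const: "p \<in> U \<Longrightarrow> ip (restr \<xi>) (restr \<xi>) p = 1"
  by (simp add: ip_in xi_unit U_topspace)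

lemma ip_E_const: "p \<in> U \<Longrightarrow> i < DIM('e) \<Longrightarrow> j < DIM('e) \<Longrightarrow>
    ip (restr (E i)) (restr (E j)) p = (if i = j then 1 else 0)"
  by (simp add: ip_in E_orthonormal)

lemma expand_fields:
  assumes "X \<in> fields"
  shows "X = (\<Sum>i<DIM('e). ip X (restr (E i)) \<cdot> restr (E i))"
proof
  fix p show "X p = (\<Sum>i<DIM('e). ip X (restr (E i)) \<cdot> restr (E i)) p"
  proof (cases "p \<in> U")
    case True
    then show ?thesis
      using frame_expansion[OF True field_tangent[OF assms True]]
      by (simp add: sum_apply fscale_def ip_in)
  next
    case False
    then show ?thesis
      by (simp add: sum_apply fscale_def field_out[OF assms])
  qed
qed

lemma nb_rules:
  assumes "X \<in> fields" "Y \<in> fields" "Z \<in> fields" "smooth_fun_on U f"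
  shows "nb (X + Y) Z = nb X Z + nb Y Z"
    and "nb (f \<cdot> X) Y = f \<cdot> nb X Y"
    and "nb X (Y + Z) = nb X Y + nb X Z"
    and "nb X (f \<cdot> Y) = dir_deriv X f \<cdot> Y + f \<cdot> nb X Y"
    and "dir_deriv X (ip Y Z) = ip (nb X Y) Z + ip Y (nb X Z)"
proof -
  note v = assms(1-3)[THEN field_vector_field]
  note n = nabla_affine[OF v assms(4)]
  show "nb (X + Y) Z = nb X Z + nb Y Z" "nb X (Y + Z) = nb X Y + nb X Z"
    by (rule ext, simp add: nb_def restr_def n)+
  show "nb (f \<cdot> X) Y = f \<cdot> nb X Y"
  proof
    fix p show "nb (f \<cdot> X) Y p = (f \<cdot> nb X Y) p"
      by (cases "p \<in> U") (simp_all add: nb_in nb_out n fscale_def[of f "nb X Y"])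
  qed
  show "nb X (f \<cdot> Y) = dir_deriv X f \<cdot> Y + f \<cdot> nb X Y"
  proof
    fix p show "nb X (f \<cdot> Y) p = (dir_deriv X f \<cdot> Y + f \<cdot> nb X Y) p"
      using n(5)[of p] field_out[OF assms(2), of p]
      by (cases "p \<in> U") (auto simp: nb_in nb_out dir_deriv_def fscale_def)
  qed
  show "dir_deriv X (ip Y Z) = ip (nb X Y) Z + ip Y (nb X Z)"
  proof
    fix p show "dir_deriv X (ip Y Z) p = (ip (nb X Y) Z + ip Y (nb X Z)) p"
    proof (cases "p \<in> U")
      case True
      have "dir_deriv X (ip Y Z) p = X p (\<lambda>q. g q (Y q) (Z q))"
        using dir_deriv_local[OF assms(1) g_smooth[OF v(2,3)], of "ip Y Z"] by (metis dir_deriv_def ip_in)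
      then show ?thesis
        using nabla_torsion_metric(2)[OF v True] True by (simp add: ip_in nb_in)
    qed (simp add: dir_deriv_out[OF assms(1)] ip_out)
  qed
qed

lemma ip_add_left: "X \<in> fields \<Longrightarrow> Y \<in> fields \<Longrightarrow> Z \<in> fields \<Longrightarrow> ip (X + Y) Z = ip X Z + ip Y Z"
  by (auto simp: ip_def fun_eq_iff g_add_left field_tangent)

lemma ip_fscale_left: "X \<in> fields \<Longrightarrow> Z \<in> fields \<Longrightarrow> ip (f \<cdot> X) Z = f * ip X Z"
  by (auto simp: ip_def fun_eq_iff fscale_def g_scaleR_left field_tangent)

lemma ip_commute: "X \<in> fields \<Longrightarrow> Y \<in> fields \<Longrightarrow> ip X Y = ip Y X"
  by (auto simp: ip_def fun_eq_iff intro!: g_commute field_tangent)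

lemma dir_deriv_add:
  assumes "X \<in> fields" "smooth_fun_on U f" "smooth_fun_on U h"
  shows "dir_deriv X (f + h) = dir_deriv X f + dir_deriv X h"
proof
  fix p show "dir_deriv X (f + h) p = (dir_deriv X f + dir_deriv X h) p"
    using tangent_add[OF field_tangent[OF assms(1)] smooth_fun_near[OF assms(2)]
        smooth_fun_near[OF assms(3)], of p] dir_deriv_out[OF assms(1), of p]
    by (cases "p \<in> U") (simp_all add: dir_deriv_def)
qed

lemma dir_deriv_mult:
  assumes "X \<in> fields" "smooth_fun_on U f" "smooth_fun_on U h"
  shows "dir_deriv X (f * h) = f * dir_deriv X h + h * dir_deriv X f"
proof
  fix p show "dir_deriv X (f * h) p = (f * dir_deriv X h + h * dir_deriv X f) p"
    using tangent_mult[OF field_tangent[OF assms(1)] smooth_fun_near[OF assms(2)]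
        smooth_fun_near[OF assms(3)], of p] dir_deriv_out[OF assms(1), of p]
    by (cases "p \<in> U") (simp_all add: dir_deriv_def)
qed

lemma ph_add: "X \<in> fields \<Longrightarrow> Y \<in> fields \<Longrightarrow> ph (X + Y) = ph X + ph Y"
  by (rule ext) (simp add: ph_def restr_def J_def phi_add field_tangent)

lemma ph_fscale: "X \<in> fields \<Longrightarrow> ph (f \<cdot> X) = f \<cdot> ph X"
  by (rule ext) (simp add: ph_def restr_def J_def fscale_def phi_scaleR field_tangent)

lemma ph_ph: "X \<in> fields \<Longrightarrow> ph (ph X) = - X + ip (restr \<xi>) X \<cdot> restr \<xi>"
proof
  fix p assume X: "X \<in> fields"
  show "ph (ph X) p = (- X + ip (restr \<xi>) X \<cdot> restr \<xi>) p"
  proof (cases "p \<in> U")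
    case True
    then show ?thesis
      using X by (simp add: ph_in ip_in fscale_def phi_phi U_topspace field_tangent eta_dual)
  next
    case False
    then show ?thesis
      using field_out[OF X] by (simp add: ph_out fscale_def)
  qed
qed

lemma ph_skew: "X \<in> fields \<Longrightarrow> Y \<in> fields \<Longrightarrow> ip (ph X) Y = - ip X (ph Y)"
  by (rule ext) (simp add: ip_def ph_in phi_skew field_tangent)

lemma ph_xi: "ph (restr \<xi>) = 0"
  by (rule ext) (simp add: ph_def restr_def J_def phi_xi)

text \<open>Fields, \<open>ip\<close> and \<open>nb\<close> vanish outside \<open>U\<close>, so the
  required identities hold as equalities of total functions. The functions in the ring are
  constrained on \<open>U\<close> only.\<close>

sublocale fr: framed_contact fields "Collect (smooth_fun_on U)" "(\<cdot>)" ip nb dir_deriv "DIM('e)"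
  "\<lambda>i. restr (E i)" ph "restr \<xi>"
proof (standard, goal_cases)
  case (1 f)
  then show ?case by (auto simp: fun_eq_iff)
next
  case 17
  then show ?case by (rule ip_commute)
next
  case 21
  then show ?case by (rule Jacobi_fields)
next
  case (28 X i j)
  then show ?case by (intro dir_deriv_const[where a = "if i = j then 1 else 0"]) (auto simp: ip_E_const)
next
  case (29 X)
  then show ?case by (rule expand_fields)
next
  case 34
  then show ?case by (rule ph_skew)
next
  case (37 X)
  then show ?case by (intro dir_deriv_const[where a = 1]) (auto simp: ip_xi_const)
next
  case 38
  then show ?case by (rule contact_ip)
qed (simp_all add: smooth_fun_on_add smooth_fun_on_mult smooth_fun_on_uminus fields_zero fields_add
    fields_fscale fields_uminus fields_nb ip_smooth dir_deriv_smooth ip_add_left ip_fscale_left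
    dir_deriv_add dir_deriv_mult bracket_dir_deriv fscale_add_left fscale_add_right fscale_fscale
    nb_rules(1,3,5)[OF _ _ _ smooth_fun_on_const[OF U_openin]] nb_rules(2,4)[OF _ _ fields_zero]
    E_vector_field xi_vector_field fields_ph ph_add ph_fscale ph_ph ph_xi)

section \<open>Translation of the geometric quantities\<close>

lemma restr_diff: "restr (X - Y) = restr X - restr Y"
  and restr_uminus: "restr (- X) = - restr X"
  and restr_J: "restr (J X) = ph (restr X)"
  by (auto simp: restr_def fscale_def ph_def J_def fun_eq_iff)

lemma restr_sum: "restr (\<Sum>i\<in>I. W i) = (\<Sum>i\<in>I. restr (W i))"
  by (auto simp: restr_def sum_apply fun_eq_iff)

text \<open>Smoothness of \<eta> along a field is obtained from the metric, as \<eta> is the product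
  with \<xi> on \<open>U\<close>.\<close>

lemma vector_field_proj_D: "vector_field_on U X \<Longrightarrow> vector_field_on U (proj_D X)"
proof -
  assume X: "vector_field_on U X"
  then have "vector_field_on U (X - (\<lambda>p. g p (\<xi> p) (X p)) \<cdot> \<xi>)"
    by (intro vector_field_on_diff vector_field_on_fscale g_smooth xi_vector_field)
  then show ?thesis
    by (rule vector_field_on_cong)
      (simp add: proj_D_def fscale_def eta_dual U_topspace vector_field_on_tangent[OF X])
qed

lemma restr_proj_D: "vector_field_on U X \<Longrightarrow> restr (proj_D X) = fr.pr (restr X)"
proof
  fix p assume X: "vector_field_on U X"
  show "restr (proj_D X) p = fr.pr (restr X) p"
    using eta_dual[OF U_topspace vector_field_on_tangent[OF X], of p]
    by (cases "p \<in> U") (simp_all add: fr.pr_def proj_D_def ip_in fscale_def fun_eq_iff)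
qed

lemma vector_field_nabla_bar:
  "vector_field_on U X \<Longrightarrow> vector_field_on U Y \<Longrightarrow> vector_field_on U (nabla_bar X Y)"
  by (simp add: nabla_bar_def vector_field_proj_D vector_field_nabla)

lemma restr_nabla_bar:
  "vector_field_on U X \<Longrightarrow> vector_field_on U Y \<Longrightarrow>
    restr (nabla_bar X Y) = fr.nbar (restr X) (restr Y)"
  by (simp add: nabla_bar_def fr.nbar_def restr_proj_D restr_nabla vector_field_nabla)

lemma vector_field_nabla_bar_End:
  assumes "\<And>Z. vector_field_on U Z \<Longrightarrow> vector_field_on U (L Z)"
    and "vector_field_on U X" "vector_field_on U Y"
  shows "vector_field_on U (nabla_bar_End X L Y)"
  using assms by (simp add: nabla_bar_End_def vector_field_on_diff vector_field_nabla_bar)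

text \<open>General operators \<open>L\<close> with a counterpart \<open>L'\<close> on cut-off
  fields are allowed, so that the rule can be iterated for second derivatives.\<close>

lemma restr_nabla_bar_End:
  assumes "\<And>Z. vector_field_on U Z \<Longrightarrow> vector_field_on U (L Z)"
    and "\<And>Z. vector_field_on U Z \<Longrightarrow> restr (L Z) = L' (restr Z)"
    and "vector_field_on U X" "vector_field_on U Y"
  shows "restr (nabla_bar_End X L Y) = fr.nbar_End (restr X) L' (restr Y)"
  using assms
  by (simp add: nabla_bar_End_def fr.nbar_End_def restr_diff restr_nabla_bar vector_field_nabla_bar)

lemma restr_nabla_bar2_J:
  assumes "vector_field_on U X" "vector_field_on U Y" "vector_field_on U Z"
  shows "restr (nabla_bar2_End X Y J Z) = fr.nbar2_ph (restr X) (restr Y) (restr Z)"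
proof -
  have "restr (nabla_bar_End X (nabla_bar_End Y J) Z) =
      fr.nbar_End (restr X) (fr.nbar_End (restr Y) ph) (restr Z)"
    using assms
    by (intro restr_nabla_bar_End vector_field_nabla_bar_End) (auto simp: J_vector_field restr_J)
  moreover have "restr (nabla_bar_End (\<nabla> X Y) J Z) = fr.nbar_End (nb (restr X) (restr Y)) ph (restr Z)"
    using assms
    by (subst restr_nabla_bar_End[where L' = ph])
      (auto simp: J_vector_field restr_J vector_field_nabla restr_nabla)
  ultimately show ?thesis
    by (simp add: nabla_bar2_End_def fr.nbar2_ph_def restr_diff)
qed

lemma restr_laplacian_J:
  assumes "vector_field_on U Y"
  shows "restr (laplacian_J E Y) = fr.lap_ph (restr Y)"
proof -
  have "laplacian_J E Y = - (\<Sum>i<DIM('e). nabla_bar2_End (E i) (E i) J Y)"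
    by (simp add: laplacian_J_def sum_apply)
  then show ?thesis
    using assms
    by (simp add: fr.lap_ph_def restr_uminus restr_sum restr_nabla_bar2_J E_vector_field)
qed

lemma restr_tau_J:
  assumes "vector_field_on U Y"
  shows "restr (tau_J E Y) = fr.lap_ph (ph (restr Y)) - ph (fr.lap_ph (restr Y))"
  using assms by (simp add: tau_J_def restr_diff restr_J restr_laplacian_J J_vector_field)

lemma restr_T_phi: "restr (T_phi E) = fr.T"
  unfolding T_phi_def fr.T_def restr_sum
proof (rule sum.cong)
  fix i assume "i \<in> {..<DIM('e)}"
  then have v: "vector_field_on U (E i)" by (simp add: E_vector_field)
  then have "restr (\<nabla> (E i) \<xi>) = fr.A (restr (E i))"
    by (simp add: restr_nabla xi_vector_field fr.A_def)
  then show "restr (nabla_bar_End (E i) J (\<nabla> (E i) \<xi>)) =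
      fr.nbar_End (restr (E i)) ph (fr.A (restr (E i)))"
    using v
    by (subst restr_nabla_bar_End[where L' = ph])
      (auto simp: J_vector_field restr_J vector_field_nabla xi_vector_field)
qed simp

lemma restr_nabla2:
  assumes "vector_field_on U X" "vector_field_on U Y" "vector_field_on U Z"
  shows "restr (nabla2 X Y Z) = nb (restr X) (nb (restr Y) (restr Z)) - nb (nb (restr X) (restr Y)) (restr Z)"
  using assms by (simp add: nabla2_def restr_diff restr_nabla vector_field_nabla)

lemma restr_curvature:
  assumes "vector_field_on U X" "vector_field_on U Y" "vector_field_on U Z"
  shows "restr (curvature X Y Z) = fr.R (restr X) (restr Y) (restr Z)"
  using assms
  by (simp add: curvature_def restr_diff restr_nabla2 fr.R_def fr.nb_diff_left algebra_simps)

lemma rho_star_eq: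
  assumes "vector_field_on U X" "vector_field_on U Y" "p \<in> U"
  shows "rho_star E X Y p = fr.S (restr X) (ph (restr Y)) p"
proof -
  have "g p (curvature X (E i) (J (E i)) p) (J Y p) =
      ip (fr.R (restr X) (restr (E i)) (ph (restr (E i)))) (ph (restr Y)) p" if "i < DIM('e)" for i
  proof -
    have "fr.R (restr X) (restr (E i)) (ph (restr (E i))) = restr (curvature X (E i) (J (E i)))"
      using assms E_vector_field[OF that] by (simp add: restr_curvature J_vector_field restr_J)
    then show ?thesis
      using assms(3) by (simp add: ip_in restr_J[symmetric])
  qed
  then show ?thesis by (simp add: rho_star_def fr.S_def sum_apply)
qed

lemma S_out: "p \<notin> U \<Longrightarrow> fr.S X Y p = 0"
  by (simp add: fr.S_def sum_apply ip_out)

text \<open>\<open>S\<close> vanishes outside \<open>U\<close>, so equality at the points of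
  \<open>U\<close> is equality of functions, and a field over \<open>U\<close> may be replaced by
  its cut-off.\<close>

lemma rho_star_symmetric_iff:
  "(\<forall>X Y. vector_field_on U X \<longrightarrow> vector_field_on U Y \<longrightarrow>
      (\<forall>p\<in>U. rho_star E X Y p = rho_star E Y X p)) \<longleftrightarrow>
    (\<forall>X\<in>fields. \<forall>Y\<in>fields. fr.S X (ph Y) = fr.S Y (ph X))"
proof (intro iffI allI ballI impI)
  fix X Y assume *: "\<forall>X Y. vector_field_on U X \<longrightarrow> vector_field_on U Y \<longrightarrow>
      (\<forall>p\<in>U. rho_star E X Y p = rho_star E Y X p)" and X: "X \<in> fields" and Y: "Y \<in> fields"
  show "fr.S X (ph Y) = fr.S Y (ph X)"
  proof
    fix p show "fr.S X (ph Y) p = fr.S Y (ph X) p"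
      using * rho_star_eq[OF field_vector_field[OF X] field_vector_field[OF Y], of p]
        rho_star_eq[OF field_vector_field[OF Y] field_vector_field[OF X], of p]
        field_vector_field[OF X] field_vector_field[OF Y]
      by (cases "p \<in> U") (simp_all add: S_out restr_field X Y)
  qed
next
  fix X Y p assume *: "\<forall>X\<in>fields. \<forall>Y\<in>fields. fr.S X (ph Y) = fr.S Y (ph X)"
    and "vector_field_on U X" "vector_field_on U Y" "p \<in> U"
  then show "rho_star E X Y p = rho_star E Y X p"
    by (simp add: rho_star_eq)
qed

lemma tau_J_zero_iff:
  "(\<forall>Y. D_section_on U Y \<longrightarrow> (\<forall>p\<in>U. tau_J E Y p = 0)) \<longleftrightarrow>
    (\<forall>Y\<in>fields. ip (restr \<xi>) Y = 0 \<longrightarrow> fr.lap_ph (ph Y) - ph (fr.lap_ph Y) = 0)"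
proof -
  have zero: "(\<forall>p\<in>U. X p = 0) \<longleftrightarrow> restr X = 0" for X
    using restr_eq_iff[of X 0] restr_field[OF fields_zero] by simp
  have D: "D_section_on U Y \<longleftrightarrow> vector_field_on U Y \<and> ip (restr \<xi>) (restr Y) = 0" for Y
    using eta_dual[OF U_topspace vector_field_on_tangent]
    by (auto simp: D_section_on_def ip_def fun_eq_iff)
  show ?thesis
    unfolding zero
  proof (intro iffI allI ballI impI)
    fix Y assume *: "\<forall>Y. D_section_on U Y \<longrightarrow> restr (tau_J E Y) = 0"
      and Y: "Y \<in> fields" "ip (restr \<xi>) Y = 0"
    then have "D_section_on U Y"
      by (simp add: D field_vector_field restr_field)
    then show "fr.lap_ph (ph Y) - ph (fr.lap_ph Y) = 0"
      using * restr_tau_J[OF field_vector_field[OF Y(1)]] Y by (simp add: restr_field)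
  next
    fix Y assume *: "\<forall>Y\<in>fields. ip (restr \<xi>) Y = 0 \<longrightarrow> fr.lap_ph (ph Y) - ph (fr.lap_ph Y) = 0"
      and "D_section_on U Y"
    then have "vector_field_on U Y" "ip (restr \<xi>) (restr Y) = 0"
      by (simp_all add: D)
    then show "restr (tau_J E Y) = 0"
      using * by (simp only: restr_tau_J restr_fields)
  qed
qed

text \<open>Supplies the hypothesis \<open>tau\<close> of \<open>fr.harmonic_iff_symmetric\<close>;
  the factor \<open>h\<close> is minus the squared norm of \<nabla>\<xi>.\<close>

lemma Laplacian_xi:
  assumes "\<And>p. p \<in> U \<Longrightarrow> tau_xi E p = 0"
  shows "(\<Sum>i<DIM('e). fr.A2 (restr (E i)) (restr (E i))) =
    - (\<Sum>i<DIM('e). ip (fr.A (restr (E i))) (fr.A (restr (E i)))) \<cdot> restr \<xi>" (is "?L = - ?h \<cdot> _")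
proof
  fix p show "?L p = (- ?h \<cdot> restr \<xi>) p"
  proof (cases "p \<in> U")
    case True
    have A: "fr.A (restr (E i)) = restr (\<nabla> (E i) \<xi>)" if "i < DIM('e)" for i
      using that by (simp add: fr.A_def restr_nabla E_vector_field xi_vector_field)
    have "restr (laplacian_xi E) = - ?L"
      by (simp add: laplacian_xi_def restr_uminus restr_sum restr_nabla2 E_vector_field
          xi_vector_field fr.A2_def fr.A_def)
    from fun_cong[OF this, of p] have "laplacian_xi E p = - ?L p"
      by (simp only: restr_in[OF True] uminus_apply)
    moreover have "norm2_nabla_xi E p = ?h p"
      using True by (simp add: norm2_nabla_xi_def sum_apply A ip_in)
    moreover have "laplacian_xi E p = norm2_nabla_xi E p *\<^sub>R \<xi> p"
      using assms[OF True] by (simp add: tau_xi_def fscale_def)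
    ultimately have "- ?L p = ?h p *\<^sub>R \<xi> p"
      by (simp only:)
    then have "?L p = - (?h p *\<^sub>R \<xi> p)"
      by (rule minus_equation_iff[THEN iffD1, symmetric])
    then show ?thesis using True by (simp add: fscale_def)
  next
    case False
    then have "?L p = 0"
      by (simp add: sum_apply fr.A2_def fr.A_def nb_out)
    then show ?thesis using False by (simp add: fscale_def)
  qed
qed

lemma harmonic_iff_rho_star_symmetric:
  assumes tau: "\<And>p. p \<in> U \<Longrightarrow> tau_xi E p = 0"
  shows "(\<forall>p\<in>U. (tau_xi E + (1/2) *\<^sub>R J (T_phi E)) p = 0) \<and>
      (\<forall>Y. D_section_on U Y \<longrightarrow> (\<forall>p\<in>U. tau_J E Y p = 0)) \<longleftrightarrow>
    (\<forall>X Y. vector_field_on U X \<longrightarrow> vector_field_on U Y \<longrightarrow>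
      (\<forall>p\<in>U. rho_star E X Y p = rho_star E Y X p))"
proof -
  \<comment> \<open>As \<open>tau_xi E\<close> vanishes on \<open>U\<close>, the first harmonicity
    equation reduces to J T(\<phi>) = 0.\<close>
  have "(\<forall>p\<in>U. (tau_xi E + (1/2) *\<^sub>R J (T_phi E)) p = 0) \<longleftrightarrow> restr (J (T_phi E)) = restr 0"
    unfolding restr_eq_iff by (simp add: tau scaleR_fun_def[of _ "J _"])
  then have T: "(\<forall>p\<in>U. (tau_xi E + (1/2) *\<^sub>R J (T_phi E)) p = 0) \<longleftrightarrow> ph fr.T = 0"
    by (simp add: restr_J restr_T_phi restr_field fields_zero)
  have "- (\<Sum>i<DIM('e). ip (fr.A (restr (E i))) (fr.A (restr (E i)))) \<in> Collect (smooth_fun_on U)"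
    by (intro fr.F_uminus fr.F_sum fr.F_ip fr.A_V fr.E_V)
  from fr.harmonic_iff_symmetric[OF Laplacian_xi[OF tau] this]
  show ?thesis
    unfolding T tau_J_zero_iff rho_star_symmetric_iff .
qed

end

theorem theorem2p2:
  fixes M :: "'a topology"
    and charts :: "('a set \<times> ('a \<Rightarrow> 'e::euclidean_space)) set"
    and g :: "'a \<Rightarrow> 'a tangent \<Rightarrow> 'a tangent \<Rightarrow> real"
    and nabla :: "'a vfield \<Rightarrow> 'a vfield \<Rightarrow> 'a vfield"
    and phi :: "'a \<Rightarrow> 'a tangent \<Rightarrow> 'a tangent"
    and xi :: "'a vfield"
    and eta :: "'a \<Rightarrow> 'a tangent \<Rightarrow> real"
    and n :: nat
  assumes "DIM('e) = 2 * n + 1"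
    and "almost_contact_metric_structure M charts g nabla phi xi eta"
    and "almost_contact_metric_structure.H_contact M charts g nabla phi xi eta"
  shows "almost_contact_metric_structure.harmonic M charts g nabla phi xi eta \<longleftrightarrow>
    almost_contact_metric_structure.rho_star_symmetric M charts g nabla phi"
proof -
  interpret almost_contact_metric_structure M charts g nabla phi xi eta
    by (rule assms(2))
  have H: contact_metric harmonic_unit_xi
    using assms(3) by (simp_all add: H_contact_def)
  \<comment> \<open>Harmonicity and symmetry quantify over the same frames, so they are compared for
    one frame at a time.\<close>
  have iff: "(\<forall>p\<in>U. (tau_xi E + (1/2) *\<^sub>R J (T_phi E)) p = 0) \<and>
      (\<forall>Y. D_section_on U Y \<longrightarrow> (\<forall>p\<in>U. tau_J E Y p = 0)) \<longleftrightarrow>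
    (\<forall>X Y. vector_field_on U X \<longrightarrow> vector_field_on U Y \<longrightarrow>
      (\<forall>p\<in>U. rho_star E X Y p = rho_star E Y X p))" if "orthonormal_frame_on U E" for U E
  proof -
    interpret contact_frame M charts g nabla phi xi eta U E
      by unfold_locales (fact that, fact H(1))
    show ?thesis
      using H(2) that by (intro harmonic_iff_rho_star_symmetric) (auto simp: harmonic_unit_xi_def)
  qed
  have "harmonic \<longleftrightarrow> (\<forall>U E. orthonormal_frame_on U E \<longrightarrow>
      (\<forall>X Y. vector_field_on U X \<longrightarrow> vector_field_on U Y \<longrightarrow>
        (\<forall>p\<in>U. rho_star E X Y p = rho_star E Y X p)))"
    unfolding harmonic_def by (intro iff_allI imp_cong refl iff)
  then show ?thesis
    unfolding rho_star_symmetric_def by (simp only: all_simps)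
qed

end
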